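(* Let $K$ be an infinite field, let $I$ be a zero-dimensional (i.e. $\dim(P/I)=0$) strongly stable monomial ideal in $P=K[x_1,\dots,x_n]$, and let $\mathcal{L}=(L_{ij}\mid i=1,\dots,n+1,\ j\ge1)$ be a distraction matrix for the ring $\overline{P}=K[x_1,\dots,x_n,x_{n+1}]$, with entries in $\overline{P}_1$, which is radical for $I$ (regarded as the ideal $I\overline{P}$ of $\overline{P}$). Then $D_{\mathcal{L}}(I)$ (i.e. $D_{\mathcal{L}}(I\overline{P})$) is the ideal of a finite set of $K$-rational points in $\mathbb{P}^n_K$ such that $$\mathrm{gin}_{\mathrm{drl}}\big(D_{\mathcal{L}}(I)\big)=I\overline{P}.$$
   Context: The following definitions are for a polynomial ring $R=K[x_1,\dots,x_m]$, standard graded (here they are applied with $R=\overline{P}$, $m=n+1$, and strong stability with $R=P$). A distraction matrix is an infinite matrix $\mathcal{L}=(L_{ij}\mid i=1,\dots,m,\ j\ge 1)$ with $L_{ij}\in R_1$ such that (a) $\langle L_{1j_1},\dots,L_{mj_m}\rangle=R_1$ ($K$-linear span) for all $j_1,\dots,j_m\ge 1$; (b) there is $N$ with $L_{ij}=L_{iN}$ for all $i$ and all $j>N$. For $t=x_1^{\alpha_1}\cdots x_m^{\alpha_m}$ put $D_{\mathcal{L}}(t)=\prod_{i=1}^m\prod_{j=1}^{\alpha_i}L_{ij}$ and extend $D_{\mathcal{L}}$ to $R$ by $K$-linearity; $D_{\mathcal{L}}(V)$ is the image of a subspace $V$. For a monomial ideal $J$, $D_{\mathcal{L}}(J)$ is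 a homogeneous ideal. Irreducible monomial ideals are those of the form $(x_{i_1}^{a_1},\dots,x_{i_h}^{a_h})$; every monomial ideal is an intersection of irreducible monomial ideals, its irreducible components (those of the irredundant decomposition). $\mathcal{L}$ is radical for $(x_{i_1}^{a_1},\dots,x_{i_h}^{a_h})$ if the vector spaces $\langle L_{i_1s_1},\dots,L_{i_hs_h}\rangle$ are pairwise distinct as $(s_1,\dots,s_h)$ ranges over all tuples with $1\le s_k\le a_k$. $\mathcal{L}$ is radical for a monomial ideal if it is radical for all its irreducible components. A monomial ideal $I$ is strongly stable if for every power product $t\in I$, every $j$ with $x_j\mid t$ and every $i\le j$, one has $x_i\,t/x_j\in I$. $\mathrm{drl}$ denotes DegRevLex with $x_1>\dots>x_m$, $\mathrm{in}_{\mathrm{drl}}$ the corresponding initial ideal. A matrix $g\in GL(m,K)$ acts on $R$ by $g(x_j)=\sum_i g_{ij}x_i$; $\mathrm{gin}_{\mathrm{drl}}(J)$ is the monomial ideal equal to $\mathrm{in}_{\mathrm{drl}}(g(J))$ for all $g$ in a suitable nonempty Zariski-open subset of $GL(m,K)$ (well defined by a known theorem). *)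

theory Defs
  imports
    "HOL-Library.Poly_Mapping"
    "HOL-Algebra.QuotRing"
    "Jordan_Normal_Form.Matrix"
begin

section \<open>Polynomial rings\<close>

text \<open>
  Indices start at \<open>0\<close> throughout: the variables \<open>x\<^sub>1, \<dots>, x\<^sub>m\<close> are numbered \<open>0, \<dots>, m - 1\<close>, and the
  columns of a distraction matrix are numbered \<open>0, 1, 2, \<dots>\<close>.  In this way \<open>K[x\<^sub>1, \<dots>, x\<^sub>n]\<close> is
  literally a subset of \<open>K[x\<^sub>1, \<dots>, x\<^sub>n\<^sub>+\<^sub>1]\<close>.
\<close>

abbreviation "lookup \<equiv> Poly_Mapping.lookup"
abbreviation "keys \<equiv> Poly_Mapping.keys"

type_synonym 'v pp = "'v \<Rightarrow>\<^sub>0 nat"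
type_synonym ('v, 'k) mpoly = "'v pp \<Rightarrow>\<^sub>0 'k"

definition const :: "'k \<Rightarrow> ('v, 'k::field) mpoly" where
  "const c = Poly_Mapping.single 0 c"

definition mon :: "'v pp \<Rightarrow> ('v, 'k::field) mpoly" where
  "mon t = Poly_Mapping.single t 1"

definition var :: "'v \<Rightarrow> ('v, 'k::field) mpoly" where
  "var i = mon (Poly_Mapping.single i 1)"

definition scale :: "'k \<Rightarrow> ('v, 'k::field) mpoly \<Rightarrow> ('v, 'k) mpoly" where
  "scale c p = const c * p"

definition pp_deg :: "'v pp \<Rightarrow> nat" where
  "pp_deg t = (\<Sum>i\<in>keys t. lookup t i)"

definition homogeneous :: "('v, 'k::field) mpoly \<Rightarrow> bool" where
  "homogeneous p \<longleftrightarrow> (\<exists>d. \<forall>t\<in>keys p. pp_deg t = d)"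

definition polys_over :: "'v set \<Rightarrow> ('v, 'k::field) mpoly set" where
  "polys_over V = {p. \<forall>t\<in>keys p. keys t \<subseteq> V}"

definition poly_ring :: "nat \<Rightarrow> (nat, 'k::field) mpoly ring" where
  "poly_ring m = \<lparr>carrier = polys_over {..<m}, monoid.mult = (*), one = 1, zero = 0, add = (+)\<rparr>"

definition linear_forms :: "nat \<Rightarrow> (nat, 'k::field) mpoly set" where
  "linear_forms m = {p \<in> carrier (poly_ring m). \<forall>t\<in>keys p. pp_deg t = 1}"

text \<open>
  The ring homomorphism out of the polynomial ring that is \<open>h\<close> on coefficients and sends the
  variable \<open>i\<close> to \<open>\<phi> i\<close>.
\<close>
definition poly_hom :: "('k \<Rightarrow> 'r) \<Rightarrow> ('v \<Rightarrow> 'r) \<Rightarrow> ('v, 'k::field) mpoly \<Rightarrow> 'r::comm_ring_1" where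
  "poly_hom h \<phi> p = (\<Sum>t\<in>keys p. h (lookup p t) * (\<Prod>i\<in>keys t. \<phi> i ^ lookup t i))"

abbreviation eval :: "('v \<Rightarrow> 'k) \<Rightarrow> ('v, 'k::field) mpoly \<Rightarrow> 'k" where
  "eval \<equiv> poly_hom (\<lambda>c. c)"

interpretation mpoly: vector_space "scale :: 'k::field \<Rightarrow> ('v, 'k) mpoly \<Rightarrow> ('v, 'k) mpoly"
  by unfold_locales
    (simp_all add: scale_def const_def distrib_left distrib_right single_add mult_single
      mult.assoc[symmetric])

lemma polys_over_closed:
  assumes "p \<in> polys_over V" "q \<in> polys_over V"
  shows "p + q \<in> polys_over V" "p * q \<in> polys_over V" "- p \<in> polys_over V"
proof -
  show "p + q \<in> polys_over V"
    using assms keys_add[of p q] unfolding polys_over_def by blast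
  show "- p \<in> polys_over V"
    using assms by (auto simp: polys_over_def in_keys_iff)
  show "p * q \<in> polys_over V"
    unfolding polys_over_def
  proof (intro CollectI ballI)
    fix t assume "t \<in> keys (p * q)"
    then obtain a b where "t = a + b" "a \<in> keys p" "b \<in> keys q"
      using keys_mult[of p q] by blast
    then show "keys t \<subseteq> V"
      using assms keys_add[of a b] unfolding polys_over_def by blast
  qed
qed

lemma cring_poly_ring: "cring (poly_ring m :: (nat, 'k::field) mpoly ring)" (is "cring ?R")
proof (rule cringI)
  have one_zero: "(0 :: (nat, 'k) mpoly) \<in> polys_over {..<m}" "(1 :: (nat, 'k) mpoly) \<in> polys_over {..<m}"
    by (auto simp: polys_over_def)
  show "abelian_group ?R"
  proof (rule abelian_groupI)
    fix p assume "p \<in> carrier ?R"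
    then show "\<exists>q\<in>carrier ?R. q \<oplus>\<^bsub>?R\<^esub> p = \<zero>\<^bsub>?R\<^esub>"
      by (intro bexI[of _ "- p"]) (auto simp: poly_ring_def polys_over_closed)
  qed (auto simp: poly_ring_def add.assoc add.commute polys_over_closed one_zero)
  show "comm_monoid ?R"
    by (rule comm_monoidI)
      (auto simp: poly_ring_def mult.assoc mult.commute polys_over_closed one_zero)
qed (auto simp: poly_ring_def distrib_right)


section \<open>Krull dimension\<close>

definition prime_chain :: "('a, 'b) ring_scheme \<Rightarrow> nat \<Rightarrow> (nat \<Rightarrow> 'a set) \<Rightarrow> bool" where
  "prime_chain R d p \<longleftrightarrow> (\<forall>i\<le>d. primeideal (p i) R) \<and> (\<forall>i<d. p i \<subset> p (Suc i))"

definition has_krull_dim :: "('a, 'b) ring_scheme \<Rightarrow> nat \<Rightarrow> bool" where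
  "has_krull_dim R d \<longleftrightarrow> (\<exists>p. prime_chain R d p) \<and> (\<forall>e p. prime_chain R e p \<longrightarrow> e \<le> d)"


section \<open>Monomial ideals\<close>

definition monomial_ideal :: "nat \<Rightarrow> (nat, 'k::field) mpoly set \<Rightarrow> bool" where
  "monomial_ideal m J \<longleftrightarrow>
    (\<exists>S. (\<forall>t\<in>S. keys t \<subseteq> {..<m}) \<and> J = Idl\<^bsub>poly_ring m\<^esub> (mon ` S))"

definition strongly_stable :: "(nat, 'k::field) mpoly set \<Rightarrow> bool" where
  "strongly_stable J \<longleftrightarrow>
    (\<forall>t j i. mon t \<in> J \<longrightarrow> j \<in> keys t \<longrightarrow> i \<le> j \<longrightarrow>
      mon (t - Poly_Mapping.single j 1 + Poly_Mapping.single i 1) \<in> J)"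

text \<open>
  A tuple of distinct variables \<open>x\<^bsub>i\<^sub>1\<^esub>, \<dots>, x\<^bsub>i\<^sub>h\<^esub>\<close> with exponents \<open>a\<^sub>1, \<dots>, a\<^sub>h \<ge> 1\<close> is encoded by the
  power product \<open>a\<close> with \<open>keys a = {i\<^sub>1, \<dots>, i\<^sub>h}\<close> and these exponents.
\<close>
definition irr_monomial_ideal :: "nat \<Rightarrow> nat pp \<Rightarrow> (nat, 'k::field) mpoly set" where
  "irr_monomial_ideal m a = Idl\<^bsub>poly_ring m\<^esub> ((\<lambda>i. var i ^ lookup a i) ` keys a)"

text \<open>
  The intersection is taken inside the ring, so that the unit ideal has the empty decomposition.
\<close>
definition irredundant_decomposition ::
  "nat \<Rightarrow> (nat, 'k::field) mpoly set \<Rightarrow> (nat, 'k) mpoly set set \<Rightarrow> bool" where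
  "irredundant_decomposition m J C \<longleftrightarrow>
    finite C \<and>
    (\<forall>Q\<in>C. \<exists>a. keys a \<subseteq> {..<m} \<and> Q = irr_monomial_ideal m a) \<and>
    carrier (poly_ring m) \<inter> \<Inter> C = J \<and>
    (\<forall>D. D \<subset> C \<longrightarrow> carrier (poly_ring m) \<inter> \<Inter> D \<noteq> J)"

definition irreducible_component ::
  "nat \<Rightarrow> (nat, 'k::field) mpoly set \<Rightarrow> (nat, 'k) mpoly set \<Rightarrow> bool" where
  "irreducible_component m J Q \<longleftrightarrow> (\<exists>C. irredundant_decomposition m J C \<and> Q \<in> C)"


section \<open>Distractions\<close>

definition distraction_matrix :: "nat \<Rightarrow> (nat \<Rightarrow> nat \<Rightarrow> (nat, 'k::field) mpoly) \<Rightarrow> bool" where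
  "distraction_matrix m L \<longleftrightarrow>
    (\<forall>i<m. \<forall>j. L i j \<in> linear_forms m) \<and>
    (\<forall>js :: nat \<Rightarrow> nat. mpoly.span ((\<lambda>i. L i (js i)) ` {..<m}) = linear_forms m) \<and>
    (\<exists>N. \<forall>i<m. \<forall>j>N. L i j = L i N)"

definition distraction ::
  "nat \<Rightarrow> (nat \<Rightarrow> nat \<Rightarrow> (nat, 'k::field) mpoly) \<Rightarrow> (nat, 'k) mpoly \<Rightarrow> (nat, 'k) mpoly" where
  "distraction m L p =
    (\<Sum>t\<in>keys p. scale (lookup p t) (\<Prod>i<m. \<Prod>j<lookup t i. L i j))"

definition radical_for_irr :: "(nat \<Rightarrow> nat \<Rightarrow> (nat, 'k::field) mpoly) \<Rightarrow> nat pp \<Rightarrow> bool" where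
  "radical_for_irr L a \<longleftrightarrow>
    inj_on (\<lambda>s. mpoly.span ((\<lambda>i. L i (s i)) ` keys a)) (\<Pi>\<^sub>E i\<in>keys a. {..<lookup a i})"

definition radical_for ::
  "nat \<Rightarrow> (nat \<Rightarrow> nat \<Rightarrow> (nat, 'k::field) mpoly) \<Rightarrow> (nat, 'k) mpoly set \<Rightarrow> bool" where
  "radical_for m L J \<longleftrightarrow>
    (\<forall>a. keys a \<subseteq> {..<m} \<longrightarrow> irreducible_component m J (irr_monomial_ideal m a) \<longrightarrow>
      radical_for_irr L a)"


section \<open>Initial and generic initial ideals\<close>

text \<open>DegRevLex for \<open>x\<^sub>1 > x\<^sub>2 > \<dots>\<close>\<close>
definition drl_less :: "nat pp \<Rightarrow> nat pp \<Rightarrow> bool" where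
  "drl_less s t \<longleftrightarrow>
    pp_deg s < pp_deg t \<or>
    pp_deg s = pp_deg t \<and>
      (\<exists>i. lookup s i > lookup t i \<and> (\<forall>j>i. lookup s j = lookup t j))"

definition is_leading_pp :: "(nat, 'k::field) mpoly \<Rightarrow> nat pp \<Rightarrow> bool" where
  "is_leading_pp p t \<longleftrightarrow> t \<in> keys p \<and> (\<forall>s\<in>keys p. s \<noteq> t \<longrightarrow> drl_less s t)"

definition initial_ideal :: "nat \<Rightarrow> (nat, 'k::field) mpoly set \<Rightarrow> (nat, 'k) mpoly set" where
  "initial_ideal m J = Idl\<^bsub>poly_ring m\<^esub> {mon t | t p. p \<in> J \<and> is_leading_pp p t}"

definition general_linear :: "nat \<Rightarrow> 'k::field mat set" where
  "general_linear m = {g \<in> carrier_mat m m. invertible_mat g}"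

text \<open>
  The Zariski topology of \<open>GL(m,K)\<close> is the subspace topology inherited from the affine space
  of \<open>m \<times> m\<close> matrices, whose coordinate functions are indexed by pairs.
\<close>
definition zariski_open_GL :: "nat \<Rightarrow> 'k::field mat set \<Rightarrow> bool" where
  "zariski_open_GL m U \<longleftrightarrow>
    (\<exists>F \<subseteq> polys_over ({..<m} \<times> {..<m}).
      U = {g \<in> general_linear m. \<exists>f\<in>F. eval (\<lambda>ij. g $$ ij) f \<noteq> 0})"

definition GL_act :: "nat \<Rightarrow> 'k::field mat \<Rightarrow> (nat, 'k) mpoly \<Rightarrow> (nat, 'k) mpoly" where
  "GL_act m g = poly_hom const (\<lambda>j. \<Sum>i<m. scale (g $$ (i, j)) (var i))"

text \<open>
  \<open>M\<close> is the generic initial ideal of \<open>J\<close>.  Over an infinite field two nonempty Zariski-open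
  subsets of \<open>GL(m,K)\<close> meet, so there is at most one such \<open>M\<close>.
\<close>
definition is_gin :: "nat \<Rightarrow> (nat, 'k::field) mpoly set \<Rightarrow> (nat, 'k) mpoly set \<Rightarrow> bool" where
  "is_gin m J M \<longleftrightarrow>
    monomial_ideal m M \<and>
    (\<exists>U. zariski_open_GL m U \<and> U \<noteq> {} \<and> (\<forall>g\<in>U. initial_ideal m (GL_act m g ` J) = M))"


section \<open>Projective points and their ideals\<close>

text \<open>Rational points of the projective space with \<open>m\<close> homogeneous coordinates (dimension \<open>m - 1\<close>).\<close>
definition proj_rel :: "nat \<Rightarrow> ('k::field vec \<times> 'k vec) set" where
  "proj_rel m = {(v, w). v \<in> carrier_vec m - {0\<^sub>v m} \<and> w \<in> carrier_vec m - {0\<^sub>v m} \<and>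
    (\<exists>c. c \<noteq> 0 \<and> w = c \<cdot>\<^sub>v v)}"

definition proj_points :: "nat \<Rightarrow> 'k::field vec set set" where
  "proj_points m = (carrier_vec m - {0\<^sub>v m}) // proj_rel m"

definition ideal_of_points :: "nat \<Rightarrow> 'k::field vec set set \<Rightarrow> (nat, 'k) mpoly set" where
  "ideal_of_points m X =
    Idl\<^bsub>poly_ring m\<^esub> {p \<in> carrier (poly_ring m).
      homogeneous p \<and> (\<forall>x\<in>X. \<forall>v\<in>x. eval (\<lambda>i. v $ i) p = 0)}"

end

theory Submission
  imports Defs "Jordan_Normal_Form.Determinant"
begin

text \<open>
  Write \<open>D(t)\<close> for the distraction of a power product \<open>t\<close>, so that \<open>D(J)\<close> is spanned by the \<open>D(t)\<close> with
  \<open>t \<in> J\<close>.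

  Generic initial ideal.  Let \<open>J\<close> be strongly stable.  If \<open>x\<^sub>k v \<in> J\<close>, then \<open>x\<^sub>i v \<in> J\<close> for all \<open>i \<le> k\<close>,
  and \<open>D(x\<^sub>i v)\<close> is \<open>D(v)\<close> times an entry of the matrix.  In generic coordinates the variable \<open>x\<^sub>k\<close> is,
  modulo the later variables, a combination of these \<open>k\<close> entries, so \<open>x\<^sub>k D(v)\<close> lies in \<open>D(J)\<close> modulo the
  later variables, and these are negligible for DegRevLex.  Starting from \<open>D(1) = 1\<close> and multiplying
  by the variables in increasing order of their index, one finds for every \<open>t \<in> J\<close> an element of
  \<open>D(J)\<close> with leading power product \<open>t\<close>.  There can be no other leading power products, since
  in degree \<open>d\<close> the space \<open>D(J)\<close> is spanned by as many elements as \<open>J\<close> has power products of degree \<open>d\<close>.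

  Points.  To a power product \<open>t = x\<^sub>1\<^bsup>\<alpha>\<^sub>1\<^esup> \<dots> x\<^sub>n\<^bsup>\<alpha>\<^sub>n\<^esup> \<notin> I\<close> attach the point where the entries in row \<open>i\<close> and
  column \<open>\<alpha>\<^sub>i + 1\<close> vanish, \<open>i \<le> n\<close>.  There \<open>D(u)\<close> vanishes unless \<open>u\<close> divides \<open>t\<close> up to a power of
  \<open>x\<^sub>n\<^sub>+\<^sub>1\<close>, while \<open>D(t x\<^sub>n\<^sub>+\<^sub>1\<^bsup>b\<^esup>)\<close> does not vanish because the matrix is radical for a component of
  \<open>I\<close> not containing \<open>t\<close>.  By triangularity, a form vanishing at all these points is in \<open>D(I)\<close>.
\<close>

section \<open>Power products and polynomials\<close>

declare One_nat_def [simp del]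

abbreviation unit_pp :: "'v \<Rightarrow> 'v pp" where
  "unit_pp i \<equiv> Poly_Mapping.single i 1"

abbreviation pps :: "nat \<Rightarrow> nat pp set" where
  "pps m \<equiv> {t. keys t \<subseteq> {..<m}}"

text \<open>All subspaces spanned by monomials (the ring, its graded pieces, monomial ideals) are
  written this way, so that membership becomes a condition on exponents.\<close>

definition supported :: "'v pp set \<Rightarrow> ('v, 'k::field) mpoly set" where
  "supported T = {p. keys p \<subseteq> T}"

lemma keys_add_nat: "keys (s + t :: 'v pp) = keys s \<union> keys t"
  by (auto simp: in_keys_iff lookup_add)

lemma pp_deg_superset:
  assumes "finite A" "keys t \<subseteq> A"
  shows "pp_deg t = (\<Sum>i\<in>A. lookup t i)"
  unfolding pp_deg_def by (rule sum.mono_neutral_left) (use assms in \<open>auto simp: in_keys_iff\<close>)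

lemma pp_deg_add: "pp_deg (s + t) = pp_deg s + pp_deg t"
proof -
  let ?A = "keys s \<union> keys t"
  have "pp_deg (s + t) = (\<Sum>i\<in>?A. lookup (s + t) i)"
    by (rule pp_deg_superset) (auto simp: keys_add_nat)
  also have "\<dots> = (\<Sum>i\<in>?A. lookup s i) + (\<Sum>i\<in>?A. lookup t i)"
    by (simp add: lookup_add sum.distrib)
  also have "\<dots> = pp_deg s + pp_deg t"
    by (simp add: pp_deg_superset[of ?A])
  finally show ?thesis .
qed

lemma pp_deg_single [simp]: "pp_deg (Poly_Mapping.single i c) = c"
  by (cases "c = 0") (simp_all add: pp_deg_def)

lemma pp_deg_zero [simp]: "pp_deg 0 = 0"
  by (simp add: pp_deg_def)

lemma pp_eq_zero: "pp_deg t = 0 \<Longrightarrow> t = 0"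
  by (auto simp: pp_deg_def in_keys_iff intro!: poly_mapping_eqI)

lemma pp_diff_add: "(\<And>i. lookup s i \<le> lookup t i) \<Longrightarrow> t = s + (t - s :: 'v pp)"
  by (rule poly_mapping_eqI) (simp add: lookup_add lookup_minus)

lemma pp_unit_diff: "i \<in> keys t \<Longrightarrow> t = unit_pp i + (t - unit_pp i)"
  by (rule pp_diff_add) (auto simp: lookup_single when_def in_keys_iff)

lemma pp_deg_1E:
  assumes "pp_deg t = 1"
  obtains i where "t = unit_pp i"
proof -
  have "t \<noteq> 0" using assms by auto
  then obtain i where i: "i \<in> keys t" by (metis all_not_in_conv keys_eq_empty)
  define u where "u = t - unit_pp i"
  have tu: "t = unit_pp i + u" unfolding u_def by (rule pp_unit_diff[OF i])
  then have "pp_deg u = 0" using assms by (simp add: pp_deg_add)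
  then have "u = 0" by (rule pp_eq_zero)
  then show ?thesis using that tu by simp
qed

lemma finite_pps_deg: "finite {t \<in> pps m. pp_deg t = d}"
proof (induction d)
  case 0
  have "{t \<in> pps m. pp_deg t = 0} \<subseteq> {0}" by (auto dest: pp_eq_zero)
  then show ?case by (rule finite_subset) simp
next
  case (Suc d)
  have "{t \<in> pps m. pp_deg t = Suc d} \<subseteq>
    (\<Union>i<m. (\<lambda>u. unit_pp i + u) ` {t \<in> pps m. pp_deg t = d})"
  proof
    fix t assume t: "t \<in> {t \<in> pps m. pp_deg t = Suc d}"
    then have "t \<noteq> 0" by auto
    then obtain i where i: "i \<in> keys t" by (metis all_not_in_conv keys_eq_empty)
    define u where "u = t - unit_pp i"
    have tu: "t = unit_pp i + u" unfolding u_def by (rule pp_unit_diff[OF i])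
    have "u \<in> pps m" "pp_deg u = d" "i < m"
      using t i unfolding tu by (auto simp: pp_deg_add keys_add_nat)
    then show "t \<in> (\<Union>i<m. (\<lambda>u. unit_pp i + u) ` {t \<in> pps m. pp_deg t = d})"
      using tu by auto
  qed
  then show ?case by (rule finite_subset) (use Suc in auto)
qed

section \<open>Polynomials as combinations of monomials\<close>

lemma scale_mon: "scale c (mon t) = Poly_Mapping.single t c"
  by (simp add: scale_def const_def mon_def mult_single)

lemma scale_mult: "scale c p * q = scale c (p * q)" "p * scale c q = scale c (p * q)"
  by (simp_all add: scale_def mult.assoc mult.left_commute)

lemma mon_add: "mon (s + t) = mon s * mon t"
  by (simp add: mon_def mult_single)

lemma mon_zero [simp]: "mon 0 = 1"
  by (simp add: mon_def)

lemma lookup_mon: "lookup (mon t) u = (if u = t then 1 else 0)"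
  by (simp add: mon_def lookup_single when_def)

lemma keys_mon [simp]: "keys (mon t :: ('v, 'k::field) mpoly) = {t}"
  by (simp add: mon_def)

lemma lookup_scale: "lookup (scale c p) t = c * lookup p t"
proof -
  have "scale c p = Poly_Mapping.map ((*) c) p"
    by (simp add: scale_def const_def mult_map_scale_conv_mult)
  then show ?thesis by (simp add: map.rep_eq when_def)
qed

lemma mpoly_eq_sum:
  assumes "finite A" "keys p \<subseteq> A"
  shows "p = (\<Sum>t\<in>A. scale (lookup p t) (mon t))"
proof (rule poly_mapping_eqI)
  fix u
  have "lookup (\<Sum>t\<in>A. scale (lookup p t) (mon t)) u = (\<Sum>t\<in>A. if u = t then lookup p t else 0)"
    by (simp add: lookup_sum lookup_scale lookup_mon if_distrib cong: if_cong)
  also have "\<dots> = lookup p u"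
    using assms by (auto simp: in_keys_iff)
  finally show "lookup p u = lookup (\<Sum>t\<in>A. scale (lookup p t) (mon t)) u" by simp
qed

lemma subspace_supported: "mpoly.subspace (supported T :: ('v, 'k::field) mpoly set)"
proof (rule mpoly.subspaceI)
  fix x y :: "('v, 'k) mpoly" and c
  assume "x \<in> supported T" "y \<in> supported T"
  then show "x + y \<in> supported T" "scale c x \<in> supported T"
    using keys_add[of x y] by (auto simp: supported_def in_keys_iff lookup_scale)
qed (simp add: supported_def)

lemma supported_eq_span: "supported T = mpoly.span (mon ` T)"
proof
  show "mpoly.span (mon ` T) \<subseteq> supported T"
    by (rule mpoly.span_minimal[OF _ subspace_supported]) (auto simp: supported_def)
  show "supported T \<subseteq> mpoly.span (mon ` T)"
  proof
    fix p assume "p \<in> supported T"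
    then have "(\<Sum>t\<in>keys p. scale (lookup p t) (mon t)) \<in> mpoly.span (mon ` T)"
      by (intro mpoly.span_sum mpoly.span_scale mpoly.span_base) (auto simp: supported_def)
    then show "p \<in> mpoly.span (mon ` T)"
      using mpoly_eq_sum[of "keys p" p] by simp
  qed
qed

lemma supported_mono: "S \<subseteq> T \<Longrightarrow> supported S \<subseteq> supported T"
  by (auto simp: supported_def)

lemma mon_in_supported [simp]: "mon t \<in> supported T \<longleftrightarrow> t \<in> T"
  by (simp add: supported_def)

lemma supported_mult:
  assumes "p \<in> supported S" "q \<in> supported T" "\<And>s t. s \<in> S \<Longrightarrow> t \<in> T \<Longrightarrow> s + t \<in> U"
  shows "p * q \<in> supported U"
  using assms keys_mult[of p q] by (fastforce simp: supported_def)

lemma polys_over_eq: "polys_over V = supported {t. keys t \<subseteq> V}"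
  by (auto simp: polys_over_def supported_def)

lemma carrier_poly_ring: "carrier (poly_ring m) = supported (pps m)"
  by (simp add: poly_ring_def polys_over_eq)

lemma poly_ring_simps [simp]:
  "\<zero>\<^bsub>poly_ring m\<^esub> = 0" "\<one>\<^bsub>poly_ring m\<^esub> = 1"
  "p \<oplus>\<^bsub>poly_ring m\<^esub> q = p + q" "p \<otimes>\<^bsub>poly_ring m\<^esub> q = p * q"
  by (simp_all add: poly_ring_def)

lemma linear_forms_eq: "linear_forms m = mpoly.span (var ` {..<m})"
proof -
  have "linear_forms m = supported {t \<in> pps m. pp_deg t = 1}"
    by (auto simp: linear_forms_def carrier_poly_ring supported_def)
  moreover have "{t \<in> pps m. pp_deg t = 1} = unit_pp ` {..<m}"
    by (auto elim!: pp_deg_1E)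
  ultimately show ?thesis
    by (simp add: supported_eq_span image_image var_def)
qed

lemma mult_in_span:
  assumes "x \<in> mpoly.span A" "\<And>a. a \<in> A \<Longrightarrow> y * a \<in> mpoly.span B"
  shows "y * x \<in> mpoly.span B"
  using assms(1)
proof (induction rule: mpoly.span_induct_alt)
  case base
  then show ?case by (simp add: mpoly.span_zero)
next
  case (step c a x)
  then show ?case
    by (simp add: distrib_left scale_mult mpoly.span_add mpoly.span_scale assms(2))
qed

lemma image_span_linear:
  assumes "\<And>p q. f (p + q) = f p + f q" "\<And>c p. f (scale c p) = scale c (f p)"
  shows "f ` mpoly.span B = mpoly.span (f ` B)"
proof -
  interpret module_hom scale scale f
    by unfold_locales (simp_all add: mpoly.scale_right_distrib mpoly.scale_left_distrib assms)
  show ?thesis by (rule span_image[symmetric])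
qed

lemma span_image_sum:
  assumes "finite A"
  shows "x \<in> mpoly.span (f ` A) \<longleftrightarrow> (\<exists>c. x = (\<Sum>i\<in>A. scale (c i) (f i)))"
proof
  show "x \<in> mpoly.span (f ` A)" if "\<exists>c. x = (\<Sum>i\<in>A. scale (c i) (f i))"
    using that by (auto intro!: mpoly.span_sum mpoly.span_scale intro: mpoly.span_base)
  show "\<exists>c. x = (\<Sum>i\<in>A. scale (c i) (f i))" if "x \<in> mpoly.span (f ` A)"
    using that
  proof (induction rule: mpoly.span_induct_alt)
    case base
    show ?case by (rule exI[of _ "\<lambda>_. 0"]) simp
  next
    case (step b a x)
    then obtain c j where c: "x = (\<Sum>i\<in>A. scale (c i) (f i))" and j: "a = f j" "j \<in> A" by auto
    have "scale b a + x = (\<Sum>i\<in>A. scale (c i + (if i = j then b else 0)) (f i))"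
      using assms j
      by (simp add: mpoly.scale_left_distrib sum.distrib c if_distrib[of "\<lambda>x. scale x _"] cong: if_cong)
    then show ?case by (rule exI[of _ "\<lambda>i. c i + (if i = j then b else 0)"])
  qed
qed

section \<open>Ideals as subspaces closed under multiplication by the variables\<close>

lemma var_mon: "var i * mon t = mon (unit_pp i + t)"
  by (simp add: var_def mon_add)

lemma var_power: "var i ^ e = mon (Poly_Mapping.single i e)"
  by (induction e) (simp_all add: var_mon single_add[symmetric] plus_1_eq_Suc)

text \<open>By linearity \<open>q\<close> may be taken to be a monomial, and a monomial is reached
  by multiplying with one variable at a time.\<close>

lemma subspace_mult_closed:
  assumes "mpoly.subspace J" "\<And>i p. i < m \<Longrightarrow> p \<in> J \<Longrightarrow> var i * p \<in> J"
    and "p \<in> J" "q \<in> carrier (poly_ring m)"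
  shows "q * p \<in> (J :: (nat, 'k::field) mpoly set)"
proof -
  have mon: "mon t * p \<in> J" if "t \<in> pps m" for t
    using that
  proof (induction "pp_deg t" arbitrary: t)
    case 0
    then show ?case using pp_eq_zero[of t] \<open>p \<in> J\<close> by simp
  next
    case (Suc d)
    then have "t \<noteq> 0" by auto
    then obtain i where i: "i \<in> keys t" by (metis all_not_in_conv keys_eq_empty)
    define u where "u = t - unit_pp i"
    have tu: "t = unit_pp i + u" unfolding u_def by (rule pp_unit_diff[OF i])
    have "pp_deg u = d" "u \<in> pps m" "i < m"
      using Suc.hyps(2) Suc.prems i unfolding tu by (auto simp: pp_deg_add keys_add_nat)
    then have "mon u * p \<in> J" by (intro Suc.hyps(1)) auto
    then show ?case
      using assms(2)[OF \<open>i < m\<close>] by (simp add: tu var_mon[symmetric] mult.assoc)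
  qed
  have "q * p = (\<Sum>t\<in>keys q. scale (lookup q t) (mon t)) * p"
    using mpoly_eq_sum[of "keys q" q] by simp
  also have "\<dots> = (\<Sum>t\<in>keys q. scale (lookup q t) (mon t * p))"
    by (simp add: sum_distrib_right scale_mult)
  also have "\<dots> \<in> J"
    by (intro mpoly.subspace_sum[OF assms(1)] mpoly.subspace_scale[OF assms(1)] mon)
      (use assms(4) in \<open>auto simp: carrier_poly_ring supported_def\<close>)
  finally show ?thesis .
qed

lemma ideal_of_subspace:
  assumes "mpoly.subspace J" "J \<subseteq> carrier (poly_ring m)"
    and "\<And>i p. i < m \<Longrightarrow> p \<in> J \<Longrightarrow> var i * p \<in> (J :: (nat, 'k::field) mpoly set)"
  shows "ideal J (poly_ring m)"
proof -
  let ?R = "poly_ring m :: (nat, 'k) mpoly ring"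
  interpret cring ?R by (rule cring_poly_ring)
  note mult = subspace_mult_closed[OF assms(1) assms(3)]
  show ?thesis
  proof (rule idealI)
    show "subgroup J (add_monoid ?R)"
    proof (rule group.subgroupI)
      show "Group.group (add_monoid ?R)" by (rule a_group)
      show "J \<subseteq> carrier (add_monoid ?R)" using assms(2) by simp
      show "J \<noteq> {}" using mpoly.subspace_0[OF assms(1)] by blast
      fix a b assume a: "a \<in> J"
      then have a': "- a \<in> J" by (rule mpoly.subspace_neg[OF assms(1)])
      moreover have "\<ominus>\<^bsub>?R\<^esub> a = - a"
        by (rule minus_equality) (use a a' assms(2) in auto)
      ultimately show "inv\<^bsub>add_monoid ?R\<^esub> a \<in> J"
        by (simp add: a_inv_def)
      assume "b \<in> J"
      then show "a \<otimes>\<^bsub>add_monoid ?R\<^esub> b \<in> J"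
        using mpoly.subspace_add[OF assms(1) a] by simp
    qed
  qed (use mult in \<open>auto simp: local.ring_axioms mult.commute\<close>)
qed

lemma subspace_of_ideal:
  assumes "ideal J (poly_ring m)"
  shows "mpoly.subspace (J :: (nat, 'k::field) mpoly set)"
proof -
  interpret ideal J "poly_ring m" by fact
  note J = additive_subgroup_axioms
  show ?thesis
  proof (rule mpoly.subspaceI)
    show "0 \<in> J" using additive_subgroup.zero_closed[OF J] by simp
    show "x + y \<in> J" if "x \<in> J" "y \<in> J" for x y
      using additive_subgroup.a_closed[OF J that] by simp
    show "scale c x \<in> J" if "x \<in> J" for c x
      using I_l_closed[OF that, of "const c"]
      by (simp add: scale_def carrier_poly_ring supported_def const_def)
  qed
qed

text \<open>The monomials divisible by a generator span a subspace closed under the variables, hence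
  an ideal; conversely each of them is a ring multiple of a generator.\<close>

lemma Idl_mon:
  assumes "S \<subseteq> pps m"
  shows "Idl\<^bsub>poly_ring m\<^esub> (mon ` S) =
    (supported {s + u | s u. s \<in> S \<and> u \<in> pps m} :: (nat, 'k::field) mpoly set)"
    (is "Idl\<^bsub>?R\<^esub> _ = supported ?T")
proof
  interpret cring ?R by (rule cring_poly_ring)
  have "?T \<subseteq> pps m" using assms by (force simp: keys_add_nat)
  then have "supported ?T \<subseteq> carrier ?R"
    unfolding carrier_poly_ring by (rule supported_mono)
  moreover have "var i * p \<in> supported ?T" if "i < m" "p \<in> supported ?T" for i and p :: "(nat, 'k) mpoly"
  proof (rule supported_mult[of _ "{unit_pp i}", OF _ that(2)])
    fix s t assume s: "s \<in> {unit_pp i}" and "t \<in> ?T"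
    then obtain a u where "t = a + u" "a \<in> S" "u \<in> pps m" by auto
    then show "s + t \<in> ?T"
      using s that by (intro CollectI exI[of _ a] exI[of _ "s + u"]) (auto simp: keys_add_nat ac_simps)
  qed (simp add: var_def)
  ultimately have "ideal (supported ?T :: (nat, 'k) mpoly set) ?R"
    by (rule ideal_of_subspace[OF subspace_supported])
  moreover have "mon ` S \<subseteq> supported ?T"
    by (force intro: exI[of _ 0])
  ultimately show "Idl\<^bsub>?R\<^esub> (mon ` S) \<subseteq> supported ?T"
    by (rule genideal_minimal)
  have S: "mon ` S \<subseteq> (carrier ?R :: (nat, 'k) mpoly set)"
    using assms by (auto simp: carrier_poly_ring)
  then have J: "ideal (Idl\<^bsub>?R\<^esub> (mon ` S :: (nat, 'k) mpoly set)) ?R"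
    by (rule genideal_ideal)
  then interpret J: ideal "Idl\<^bsub>?R\<^esub> (mon ` S :: (nat, 'k) mpoly set)" ?R .
  have "mon t \<in> Idl\<^bsub>?R\<^esub> (mon ` S :: (nat, 'k) mpoly set)" if "t \<in> ?T" for t
  proof -
    obtain s u where t: "t = s + u" "s \<in> S" "u \<in> pps m" using \<open>t \<in> ?T\<close> by auto
    have "mon s \<in> Idl\<^bsub>?R\<^esub> (mon ` S :: (nat, 'k) mpoly set)"
      using genideal_self[OF S] t by blast
    moreover have "mon u \<in> carrier ?R" using t by (simp add: carrier_poly_ring)
    ultimately show ?thesis using J.I_r_closed[of "mon s" "mon u"] by (simp add: t mon_add)
  qed
  then show "supported ?T \<subseteq> Idl\<^bsub>?R\<^esub> (mon ` S)"
    unfolding supported_eq_span by (intro mpoly.span_minimal subspace_of_ideal[OF J]) auto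
qed

section \<open>Substitution homomorphisms\<close>

lemma poly_hom_superset:
  assumes "comm_ring_hom h" "finite A" "keys p \<subseteq> A"
  shows "poly_hom h \<phi> p = (\<Sum>t\<in>A. h (lookup p t) * (\<Prod>i\<in>keys t. \<phi> i ^ lookup t i))"
proof -
  interpret comm_ring_hom h by fact
  show ?thesis unfolding poly_hom_def
    by (rule sum.mono_neutral_left) (use assms in \<open>auto simp: in_keys_iff\<close>)
qed

lemma prod_power_pp_superset:
  assumes "finite A" "keys t \<subseteq> A"
  shows "(\<Prod>i\<in>keys t. \<phi> i ^ lookup t i) = (\<Prod>i\<in>A. \<phi> i ^ lookup t i :: 'r::comm_monoid_mult)"
  by (rule prod.mono_neutral_left) (use assms in \<open>auto simp: in_keys_iff\<close>)

lemma prod_power_pp_add: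
  fixes \<phi> :: "'v \<Rightarrow> 'r::comm_monoid_mult" and s t :: "'v pp"
  shows "(\<Prod>i\<in>keys (s + t). \<phi> i ^ lookup (s + t) i) =
    (\<Prod>i\<in>keys s. \<phi> i ^ lookup s i) * (\<Prod>i\<in>keys t. \<phi> i ^ lookup t i)"
proof -
  let ?A = "keys s \<union> keys t"
  have "(\<Prod>i\<in>keys (s + t). \<phi> i ^ lookup (s + t) i) =
    (\<Prod>i\<in>?A. \<phi> i ^ lookup s i) * (\<Prod>i\<in>?A. \<phi> i ^ lookup t i)"
    by (subst prod_power_pp_superset[of ?A])
      (auto simp: keys_add_nat lookup_add power_add prod.distrib)
  then show ?thesis
    by (simp add: prod_power_pp_superset[of ?A])
qed

text \<open>The universal property of the polynomial ring. The map \<open>h\<close> will be the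
  identity for evaluation, \<open>const\<close> for coordinate changes, and \<open>[:c:]\<close> for
  a map to univariate polynomials.\<close>

lemma comm_ring_hom_poly_hom:
  assumes "comm_ring_hom h"
  shows "comm_ring_hom (poly_hom h \<phi> :: ('v, 'k::field) mpoly \<Rightarrow> 'r::comm_ring_1)"
proof -
  interpret h: comm_ring_hom h by fact
  let ?e = "poly_hom h \<phi> :: ('v, 'k) mpoly \<Rightarrow> 'r"
  have add: "?e (p + q) = ?e p + ?e q" for p q
  proof -
    let ?A = "keys p \<union> keys q"
    have "keys (p + q) \<subseteq> ?A" by (rule keys_add)
    then show ?thesis
      by (simp add: poly_hom_superset[OF assms, of ?A] lookup_add h.hom_add distrib_right sum.distrib)
  qed
  have zero: "?e 0 = 0" by (simp add: poly_hom_def)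
  have sum: "?e (\<Sum>x\<in>A. f x) = (\<Sum>x\<in>A. ?e (f x))" for A and f :: "'c \<Rightarrow> _"
    by (induction A rule: infinite_finite_induct) (simp_all add: add zero)
  have single: "?e (Poly_Mapping.single t c) = h c * (\<Prod>i\<in>keys t. \<phi> i ^ lookup t i)" for t c
    by (cases "c = 0") (simp_all add: poly_hom_def)
  have mult: "?e (p * q) = ?e p * ?e q" for p q
  proof -
    have "p * q = (\<Sum>s\<in>keys p. \<Sum>t\<in>keys q.
        Poly_Mapping.single (s + t) (lookup p s * lookup q t))"
      using arg_cong2[OF mpoly_eq_sum[of "keys p" p] mpoly_eq_sum[of "keys q" q], of "(*)"]
      by (simp add: sum_product scale_mon mult_single)
    then have "?e (p * q) = (\<Sum>s\<in>keys p. \<Sum>t\<in>keys q.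
        (h (lookup p s) * (\<Prod>i\<in>keys s. \<phi> i ^ lookup s i)) *
        (h (lookup q t) * (\<Prod>i\<in>keys t. \<phi> i ^ lookup t i)))"
      by (simp add: sum single prod_power_pp_add h.hom_mult ac_simps)
    then show ?thesis by (simp add: poly_hom_def sum_product)
  qed
  have "?e 1 = 1" using single[of 0 1] by simp
  then show ?thesis by unfold_locales (simp_all add: add mult zero)
qed

lemma poly_hom_single:
  assumes "comm_ring_hom h"
  shows "poly_hom h \<phi> (Poly_Mapping.single t c) = h c * (\<Prod>i\<in>keys t. \<phi> i ^ lookup t i)"
proof -
  interpret comm_ring_hom h by fact
  show ?thesis by (cases "c = 0") (simp_all add: poly_hom_def)
qed

lemma poly_hom_const: "comm_ring_hom h \<Longrightarrow> poly_hom h \<phi> (const c) = h c"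
  by (simp add: const_def poly_hom_single)

lemma poly_hom_mon: "comm_ring_hom h \<Longrightarrow> poly_hom h \<phi> (mon t) = (\<Prod>i\<in>keys t. \<phi> i ^ lookup t i)"
  by (simp add: mon_def poly_hom_single comm_ring_hom_def ring_hom_def semiring_hom_def monoid_mult_hom_def one_hom_def)

lemma poly_hom_var: "comm_ring_hom h \<Longrightarrow> poly_hom h \<phi> (var i) = \<phi> i"
  by (simp add: var_def poly_hom_mon)

lemma poly_hom_scale: "comm_ring_hom h \<Longrightarrow> poly_hom h \<phi> (scale c p) = h c * poly_hom h \<phi> p"
proof -
  assume h: "comm_ring_hom h"
  then interpret comm_ring_hom "poly_hom h \<phi>" by (rule comm_ring_hom_poly_hom)
  show ?thesis by (simp add: scale_def hom_mult poly_hom_const[OF h])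
qed

lemma comm_ring_hom_id: "comm_ring_hom (\<lambda>c :: 'k::comm_ring_1. c)"
  by unfold_locales auto

lemma comm_ring_hom_const: "comm_ring_hom (const :: 'k::field \<Rightarrow> ('v, 'k) mpoly)"
  by unfold_locales (simp_all add: const_def single_add mult_single)

lemma comm_ring_hom_pCons: "comm_ring_hom (\<lambda>c :: 'k::comm_ring_1. [:c:])"
  by unfold_locales (simp_all add: one_pCons)

section \<open>Distractions\<close>

abbreviation pps_of_deg :: "nat \<Rightarrow> nat \<Rightarrow> nat pp set" where
  "pps_of_deg m d \<equiv> {t \<in> pps m. pp_deg t = d}"

definition dist_pp :: "nat \<Rightarrow> (nat \<Rightarrow> nat \<Rightarrow> (nat, 'k::field) mpoly) \<Rightarrow> nat pp \<Rightarrow> (nat, 'k) mpoly" where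
  "dist_pp m L t = (\<Prod>i<m. \<Prod>j<lookup t i. L i j)"

lemma dist_pp_zero [simp]: "dist_pp m L 0 = 1"
  by (simp add: dist_pp_def)

text \<open>D(t) uses up the columns before \<open>lookup t i\<close> in row \<open>i\<close>; as
  columns are counted from 0, the next entry sits in column \<open>lookup t i\<close>.\<close>

lemma dist_pp_add_unit:
  assumes "i < m"
  shows "dist_pp m L (t + unit_pp i) = L i (lookup t i) * dist_pp m L t"
proof -
  have "dist_pp m L (t + unit_pp i) =
    (\<Prod>r<m. (if r = i then L i (lookup t i) else 1) * (\<Prod>j<lookup t r. L r j))"
    unfolding dist_pp_def
    by (rule prod.cong) (auto simp: lookup_add lookup_single when_def mult.commute
        lessThan_Suc simp flip: Suc_eq_plus1)
  also have "\<dots> = (\<Prod>r<m. if r = i then L i (lookup t i) else 1) * dist_pp m L t"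
    by (simp add: prod.distrib dist_pp_def)
  finally show ?thesis using assms by (simp add: prod.delta)
qed

lemma distraction_superset:
  assumes "finite A" "keys p \<subseteq> A"
  shows "distraction m L p = (\<Sum>t\<in>A. scale (lookup p t) (dist_pp m L t))"
  unfolding distraction_def dist_pp_def
  by (rule sum.mono_neutral_left) (use assms in \<open>auto simp: in_keys_iff\<close>)

lemma distraction_add: "distraction m L (p + q) = distraction m L p + distraction m L q"
proof -
  have "keys (p + q) \<subseteq> keys p \<union> keys q" by (rule keys_add)
  then show ?thesis
    by (simp add: distraction_superset[of "keys p \<union> keys q"] lookup_add sum.distrib
        mpoly.scale_left_distrib)
qed

lemma distraction_scale: "distraction m L (scale c p) = scale c (distraction m L p)"
proof -
  have "keys (scale c p) \<subseteq> keys p" by (auto simp: in_keys_iff lookup_scale)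
  then show ?thesis
    by (simp add: distraction_superset[of "keys p"] lookup_scale mpoly.scale_sum_right)
qed

lemma distraction_mon: "distraction m L (mon t) = dist_pp m L t"
  by (simp add: distraction_superset[of "{t}"] lookup_mon)

lemma distraction_image:
  "distraction m L ` supported T = mpoly.span (dist_pp m L ` T)"
  unfolding supported_eq_span
  by (subst image_span_linear)
    (simp_all add: distraction_add distraction_scale image_image distraction_mon)

lemma linear_forms_supported: "linear_forms m = supported (pps_of_deg m 1)"
  by (auto simp: linear_forms_def carrier_poly_ring supported_def)

lemma var_in_linear_forms: "i < m \<Longrightarrow> var i \<in> linear_forms m"
  by (simp add: linear_forms_supported var_def)

lemma prod_supported_deg:
  assumes "finite A" "\<And>x. x \<in> A \<Longrightarrow> f x \<in> supported (pps_of_deg m (d x))"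
  shows "(\<Prod>x\<in>A. f x) \<in> supported (pps_of_deg m (\<Sum>x\<in>A. d x))"
  using assms
proof (induction A rule: finite_induct)
  case empty
  then show ?case by (simp add: supported_def)
next
  case (insert x A)
  have "f x * prod f A \<in> supported (pps_of_deg m (d x + sum d A))"
    by (rule supported_mult[of _ "pps_of_deg m (d x)" _ "pps_of_deg m (sum d A)"])
      (use insert in \<open>auto simp: pp_deg_add keys_add_nat\<close>)
  then show ?case using insert by simp
qed

lemma dist_pp_supported:
  assumes "\<And>i j. i < m \<Longrightarrow> L i j \<in> linear_forms m" "t \<in> pps m"
  shows "dist_pp m L t \<in> supported (pps_of_deg m (pp_deg t))"
proof -
  have "dist_pp m L t \<in> supported (pps_of_deg m (\<Sum>i<m. \<Sum>j<lookup t i. 1))"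
    unfolding dist_pp_def
    by (intro prod_supported_deg) (use assms in \<open>auto simp: linear_forms_supported\<close>)
  then show ?thesis using assms(2) by (simp add: pp_deg_superset[of "{..<m}"])
qed

lemma distraction_matrixD:
  assumes "distraction_matrix m L"
  shows "i < m \<Longrightarrow> L i j \<in> linear_forms m"
    and "mpoly.span ((\<lambda>i. L i (js i)) ` {..<m}) = linear_forms m"
  using assms by (auto simp: distraction_matrix_def)

lemma var_mult_dist_pp:
  assumes "distraction_matrix m L" "i < m" "\<And>j. j < m \<Longrightarrow> t + unit_pp j \<in> T"
  shows "var i * dist_pp m L t \<in> mpoly.span (dist_pp m L ` T)"
proof -
  have "var i \<in> mpoly.span ((\<lambda>r. L r (lookup t r)) ` {..<m})"
    using distraction_matrixD(2)[OF assms(1)] var_in_linear_forms[OF assms(2)] by simp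
  then have "dist_pp m L t * var i \<in> mpoly.span (dist_pp m L ` T)"
  proof (rule mult_in_span)
    fix a assume "a \<in> (\<lambda>r. L r (lookup t r)) ` {..<m}"
    then obtain r where "r < m" "a = L r (lookup t r)" by auto
    then have "dist_pp m L t * a = dist_pp m L (t + unit_pp r)"
      by (simp add: dist_pp_add_unit mult.commute)
    then show "dist_pp m L t * a \<in> mpoly.span (dist_pp m L ` T)"
      using assms(3)[OF \<open>r < m\<close>] by (auto intro: mpoly.span_base)
  qed
  then show ?thesis by (simp add: mult.commute)
qed

lemma span_dist_pp_supported:
  assumes "distraction_matrix m L" "T \<subseteq> pps m"
  shows "mpoly.span (dist_pp m L ` T) \<subseteq> supported (pps m)"
  using dist_pp_supported[OF distraction_matrixD(1)[OF assms(1)]] assms(2)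
  by (intro mpoly.span_minimal subspace_supported) (fastforce simp: supported_def)

lemma ideal_span_dist_pp:
  assumes L: "distraction_matrix m L" and T: "T \<subseteq> pps m"
    and up: "\<And>t i. t \<in> T \<Longrightarrow> i < m \<Longrightarrow> t + unit_pp i \<in> T"
  shows "ideal (mpoly.span (dist_pp m L ` T)) (poly_ring m)"
proof (rule ideal_of_subspace)
  show "mpoly.span (dist_pp m L ` T) \<subseteq> carrier (poly_ring m)"
    using span_dist_pp_supported[OF L T] by (simp add: carrier_poly_ring)
  show "var i * p \<in> mpoly.span (dist_pp m L ` T)"
    if "i < m" "p \<in> mpoly.span (dist_pp m L ` T)" for i p
    using that(2) by (rule mult_in_span) (auto intro!: var_mult_dist_pp[OF L \<open>i < m\<close>] up)
qed (rule mpoly.subspace_span)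

text \<open>Split a variable off a monomial, write the rest in terms of distractions of degree one
  less, and multiply back with \<open>var_mult_dist_pp\<close>. In particular every form is the
  distraction of a form of the same degree.\<close>

lemma supported_deg_eq_span_dist_pp:
  assumes L: "distraction_matrix m L"
  shows "supported (pps_of_deg m d) = mpoly.span (dist_pp m L ` pps_of_deg m d)"
proof
  show "mpoly.span (dist_pp m L ` pps_of_deg m d) \<subseteq> supported (pps_of_deg m d)"
    using dist_pp_supported[OF distraction_matrixD(1)[OF L]]
    by (intro mpoly.span_minimal subspace_supported) auto
  have "mon t \<in> mpoly.span (dist_pp m L ` pps_of_deg m d)" if "t \<in> pps_of_deg m d" for t
    using that
  proof (induction d arbitrary: t)
    case 0
    then have "t = 0" using pp_eq_zero[of t] by simp
    then show ?case by (auto intro!: mpoly.span_base image_eqI[of _ _ 0])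
  next
    case (Suc d)
    then have "t \<noteq> 0" by auto
    then obtain i where i: "i \<in> keys t" by (metis all_not_in_conv keys_eq_empty)
    define u where "u = t - unit_pp i"
    have tu: "t = unit_pp i + u" unfolding u_def by (rule pp_unit_diff[OF i])
    have "u \<in> pps_of_deg m d" "i < m"
      using Suc.prems i unfolding tu by (auto simp: pp_deg_add keys_add_nat)
    have "var i * mon u \<in> mpoly.span (dist_pp m L ` pps_of_deg m (Suc d))"
      using Suc.IH[OF \<open>u \<in> pps_of_deg m d\<close>]
      by (rule mult_in_span)
        (auto intro!: var_mult_dist_pp[OF L \<open>i < m\<close>] simp: keys_add_nat pp_deg_add)
    then show ?case by (simp add: tu var_mon)
  qed
  then show "supported (pps_of_deg m d) \<subseteq> mpoly.span (dist_pp m L ` pps_of_deg m d)"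
    unfolding supported_eq_span[of "pps_of_deg m d"] by (intro mpoly.span_minimal) auto
qed

section \<open>The degree reverse lexicographic order\<close>

lemma drl_less_irrefl: "\<not> drl_less t t"
  by (auto simp: drl_less_def)

lemma drl_less_trans:
  assumes "drl_less s t" "drl_less t u"
  shows "drl_less s u"
proof (cases "pp_deg s = pp_deg t \<and> pp_deg t = pp_deg u")
  case True
  then obtain i j where i: "lookup s i > lookup t i" "\<And>k. k > i \<Longrightarrow> lookup s k = lookup t k"
    and j: "lookup t j > lookup u j" "\<And>k. k > j \<Longrightarrow> lookup t k = lookup u k"
    using assms by (auto simp: drl_less_def)
  have "lookup s (max i j) > lookup u (max i j) \<and> (\<forall>k>max i j. lookup s k = lookup u k)"
    using i j by (cases i j rule: linorder_cases) (auto simp: max_def)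
  then show ?thesis using True by (auto simp: drl_less_def)
next
  case False
  then show ?thesis using assms by (auto simp: drl_less_def)
qed

lemma drl_less_total:
  assumes "s \<noteq> t"
  shows "drl_less s t \<or> drl_less t s"
proof (cases "pp_deg s" "pp_deg t" rule: linorder_cases)
  case equal
  let ?A = "{i. lookup s i \<noteq> lookup t i}"
  have "?A \<subseteq> keys s \<union> keys t" by (auto simp: in_keys_iff)
  then have fin: "finite ?A" by (rule finite_subset) simp
  have ne: "?A \<noteq> {}" using assms by (auto intro: poly_mapping_eqI)
  define i where "i = Max ?A"
  have i: "lookup s i \<noteq> lookup t i" using Max_in[OF fin ne] by (simp add: i_def)
  have above: "lookup s j = lookup t j" if "j > i" for j
    using Max_ge[OF fin, of j] that by (fastforce simp: i_def)
  show ?thesis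
  proof (cases "lookup s i > lookup t i")
    case True
    then show ?thesis using equal above by (auto simp: drl_less_def)
  next
    case False
    then have "lookup t i > lookup s i" using i by simp
    then show ?thesis using equal above by (auto simp: drl_less_def)
  qed
qed (auto simp: drl_less_def)

lemma drl_less_add_left: "drl_less s t \<Longrightarrow> drl_less (u + s) (u + t)"
  by (auto simp: drl_less_def pp_deg_add lookup_add)

text \<open>The property of DegRevLex that makes terms in later variables negligible: the last
  variable of \<open>u\<close> does not occur in \<open>t\<close> and decides the
  comparison.\<close>

lemma drl_less_higher_variable:
  assumes "keys t \<subseteq> {..<k}" "\<not> keys u \<subseteq> {..<k}" "pp_deg u = pp_deg t"
  shows "drl_less u t"
proof -
  define i where "i = Max (keys u)"
  obtain r where r: "r \<in> keys u" "r \<ge> k" using assms(2) by (force simp: not_less)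
  then have "keys u \<noteq> {}" by auto
  then have i: "i \<in> keys u" "i \<ge> r"
    unfolding i_def using Max_in[of "keys u"] Max_ge[of "keys u" r] r(1) by simp_all
  have "i \<notin> keys t" using assms(1) i(2) r(2) by auto
  then have "lookup u i > lookup t i" using i(1) by (simp add: in_keys_iff)
  moreover have "lookup u j = lookup t j" if "j > i" for j
  proof -
    have "j \<notin> keys u"
    proof
      assume "j \<in> keys u"
      then have "j \<le> i" unfolding i_def by simp
      then show False using that by simp
    qed
    moreover have "j \<notin> keys t" using that assms(1) i(2) r(2) by auto
    ultimately show ?thesis by (simp add: in_keys_iff)
  qed
  ultimately show ?thesis using assms(3) by (auto simp: drl_less_def)
qed

lemma finite_drl_max:
  assumes "finite A" "A \<noteq> {}"
  shows "\<exists>x\<in>A. \<forall>y\<in>A. y \<noteq> x \<longrightarrow> drl_less y x"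
  using assms
proof (induction A rule: finite_ne_induct)
  case (insert a A)
  then obtain x where "x \<in> A" "\<forall>y\<in>A. y \<noteq> x \<longrightarrow> drl_less y x" by auto
  then show ?case
    using drl_less_total[of a x] drl_less_trans[of _ x a] insert.hyps by (metis insertE insertI1 insertI2)
qed simp

lemma is_leading_pp_unique:
  "is_leading_pp p s \<Longrightarrow> is_leading_pp p t \<Longrightarrow> s = t"
  unfolding is_leading_pp_def by (metis drl_less_trans drl_less_irrefl)

text \<open>In a vanishing combination the largest \<open>t\<close> with nonzero coefficient cannot
  cancel, since all other terms with nonzero coefficient have smaller leading power
  products.\<close>

lemma independent_leading_pps:
  assumes "finite A" and lead: "\<And>t. t \<in> A \<Longrightarrow> is_leading_pp (f t :: (nat, 'k::field) mpoly) t"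
  shows "inj_on f A" "\<not> mpoly.dependent (f ` A)"
proof -
  show inj: "inj_on f A"
    by (rule inj_onI) (metis lead is_leading_pp_unique)
  show "\<not> mpoly.dependent (f ` A)"
  proof
    assume "mpoly.dependent (f ` A)"
    then obtain u where u: "\<exists>v\<in>f ` A. u v \<noteq> 0" "(\<Sum>v\<in>f ` A. scale (u v) v) = 0"
      using assms(1) by (auto simp: mpoly.dependent_finite)
    define B where "B = {t \<in> A. u (f t) \<noteq> 0}"
    have "finite B" "B \<noteq> {}" using assms(1) u(1) by (auto simp: B_def)
    then obtain t where t: "t \<in> B" "\<And>s. s \<in> B \<Longrightarrow> s \<noteq> t \<Longrightarrow> drl_less s t"
      using finite_drl_max[of B] by auto
    have tA: "t \<in> A" using t by (simp add: B_def)
    have "0 = lookup (\<Sum>s\<in>A. scale (u (f s)) (f s)) t"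
      using u(2) by (simp add: sum.reindex[OF inj])
    also have "\<dots> = (\<Sum>s\<in>A. u (f s) * lookup (f s) t)"
      by (simp add: lookup_sum lookup_scale)
    also have "\<dots> = (\<Sum>s\<in>{t}. u (f s) * lookup (f s) t)"
    proof (rule sum.mono_neutral_right[OF assms(1)], use tA in simp, rule ballI)
      fix s assume s: "s \<in> A - {t}"
      show "u (f s) * lookup (f s) t = 0"
      proof (cases "s \<in> B")
        case True
        then have "drl_less s t" using t s by auto
        then have "t \<notin> keys (f s)"
          using lead[of s] s drl_less_trans[of s t s] drl_less_irrefl[of s]
          by (auto simp: is_leading_pp_def)
        then show ?thesis by (simp add: in_keys_iff)
      qed (use s in \<open>auto simp: B_def\<close>)
    qed
    finally show False
      using lead[OF tA] t(1) by (simp add: is_leading_pp_def in_keys_iff B_def)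
  qed
qed

section \<open>Leading power products of distractions\<close>

text \<open>Strong stability as a property of an exponent set alone, so that it passes to the colon
  and restricted sets of the induction below, which need not be the exponents of an ideal.\<close>

definition stable_pps :: "nat pp set \<Rightarrow> bool" where
  "stable_pps T \<longleftrightarrow> (\<forall>t\<in>T. \<forall>j\<in>keys t. \<forall>i\<le>j. t - unit_pp j + unit_pp i \<in> T)"

text \<open>
  The rows of \<open>M\<close> are in general position to the flag of the spans of the last variables.  For the
  transform of a distraction matrix under a generic coordinate change this is where genericity enters.
\<close>
definition flag_generic :: "nat \<Rightarrow> (nat \<Rightarrow> nat \<Rightarrow> (nat, 'k::field) mpoly) \<Rightarrow> bool" where
  "flag_generic m M \<longleftrightarrow> (\<forall>i<m. \<forall>j. M i j \<in> linear_forms m) \<and>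
    (\<forall>k<m. \<forall>js. var k \<in> mpoly.span ((\<lambda>i. M i (js i)) ` {..k} \<union> var ` {k<..<m}))"

text \<open>Exponents of the degree \<open>d\<close> part of the ideal generated by the variables
  \<open>k\<close>, ..., \<open>m - 1\<close>; this is where the error terms live.\<close>

abbreviation high_pps :: "nat \<Rightarrow> nat \<Rightarrow> nat \<Rightarrow> nat pp set" where
  "high_pps m k d \<equiv> {t \<in> pps_of_deg m d. \<not> keys t \<subseteq> {..<k}}"

lemma pps_add_subset: "s + t \<in> T \<Longrightarrow> T \<subseteq> pps m \<Longrightarrow> s \<in> pps m"
  by (drule subsetD, assumption) (simp add: keys_add_nat)

lemma stable_pps_colon:
  assumes "stable_pps T"
  shows "stable_pps {v. v + u \<in> T}"
  unfolding stable_pps_def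
proof (intro ballI allI impI)
  fix t j i assume t: "t \<in> {v. v + u \<in> T}" "j \<in> keys t" "i \<le> j"
  then have "(t + u) - unit_pp j + unit_pp i \<in> T"
    using assms by (auto simp: stable_pps_def keys_add_nat)
  moreover have "(t + u) - unit_pp j + unit_pp i = t - unit_pp j + unit_pp i + u"
    using t(2) by (intro poly_mapping_eqI)
      (auto simp: lookup_add lookup_minus lookup_single when_def in_keys_iff)
  ultimately show "t - unit_pp j + unit_pp i \<in> {v. v + u \<in> T}" by simp
qed

lemma stable_pps_restrict:
  assumes "stable_pps T"
  shows "stable_pps {v \<in> T. keys v \<subseteq> {..<k}}"
  unfolding stable_pps_def
proof (intro ballI allI impI)
  fix t j i assume t: "t \<in> {v \<in> T. keys v \<subseteq> {..<k}}" "j \<in> keys t" "i \<le> j"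
  then have "t - unit_pp j + unit_pp i \<in> T" using assms by (auto simp: stable_pps_def)
  moreover have "keys (t - unit_pp j) \<subseteq> keys t" by (auto simp: in_keys_iff lookup_minus)
  then have "keys (t - unit_pp j + unit_pp i) \<subseteq> {..<k}"
    using t by (auto simp: keys_add_nat)
  ultimately show "t - unit_pp j + unit_pp i \<in> {v \<in> T. keys v \<subseteq> {..<k}}" by simp
qed

text \<open>
  Strong stability enters here: since \<open>x\<^sub>k v \<in> T\<close>, all the power products \<open>x\<^sub>i v\<close> with \<open>i \<le> k\<close> lie in
  \<open>T\<close>, and modulo the variables after \<open>x\<^sub>k\<close> their distractions span \<open>x\<^sub>k D(v)\<close>.
\<close>
lemma var_mult_dist_pp_stable:
  assumes M: "flag_generic m M" and "k < m" "T \<subseteq> pps m" "stable_pps T"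
    and v: "v + unit_pp k \<in> T"
  shows "var k * dist_pp m M v \<in>
    mpoly.span (dist_pp m M ` {t \<in> T. pp_deg t = pp_deg v + 1} \<union> mon ` high_pps m (Suc k) (pp_deg v + 1))"
    (is "_ \<in> mpoly.span ?B")
proof -
  have lin: "\<And>i j. i < m \<Longrightarrow> M i j \<in> linear_forms m" using M by (simp add: flag_generic_def)
  have vm: "v \<in> pps m" using v \<open>T \<subseteq> pps m\<close> by (rule pps_add_subset)
  have Dv: "dist_pp m M v \<in> supported (pps_of_deg m (pp_deg v))"
    using vm by (intro dist_pp_supported lin)
  have "var k \<in> mpoly.span ((\<lambda>i. M i (lookup v i)) ` {..k} \<union> var ` {k<..<m})"
    using M \<open>k < m\<close> unfolding flag_generic_def by blast
  then have "dist_pp m M v * var k \<in> mpoly.span ?B"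
  proof (rule mult_in_span)
    fix a assume "a \<in> (\<lambda>i. M i (lookup v i)) ` {..k} \<union> var ` {k<..<m}"
    then consider i where "i \<le> k" "a = M i (lookup v i)" | r where "k < r" "r < m" "a = var r" by auto
    then show "dist_pp m M v * a \<in> mpoly.span ?B"
    proof cases
      case 1
      have "(v + unit_pp k) - unit_pp k + unit_pp i \<in> T"
        using \<open>stable_pps T\<close> v 1 unfolding stable_pps_def
        by (elim ballE[of _ _ "v + unit_pp k"] ballE[of _ _ k]) (auto simp: keys_add_nat)
      then have "v + unit_pp i \<in> T" by simp
      moreover have "dist_pp m M v * a = dist_pp m M (v + unit_pp i)"
        using 1 \<open>k < m\<close> by (simp add: dist_pp_add_unit mult.commute)
      ultimately show ?thesis by (auto intro!: mpoly.span_base simp: pp_deg_add)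
    next
      case 2
      have "dist_pp m M v * a \<in> supported (high_pps m (Suc k) (pp_deg v + 1))"
        using Dv
        by (rule supported_mult[of _ _ _ "{unit_pp r}"])
          (use 2 in \<open>auto simp: var_def keys_add_nat pp_deg_add\<close>)
      then show ?thesis
        unfolding supported_eq_span using mpoly.span_mono[of "mon ` high_pps m (Suc k) (pp_deg v + 1)" ?B] by blast
    qed
  qed
  then show ?thesis by (simp add: mult.commute)
qed

text \<open>Iterates the preceding lemma. After one multiplication by \<open>var k\<close> the power
  products lie in the colon of \<open>T\<close> by the remaining power of that variable, which is
  again stable, and error terms stay error terms.\<close>

lemma var_power_mult_dist_pp_stable:
  assumes M: "flag_generic m M" and "k < m" "T \<subseteq> pps m" "stable_pps T"
    and p: "p \<in> mpoly.span (dist_pp m M ` {v. v + Poly_Mapping.single k a \<in> T \<and> pp_deg v = d} \<union>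
      mon ` high_pps m (Suc k) d)"
  shows "var k ^ a * p \<in>
    mpoly.span (dist_pp m M ` {t \<in> T. pp_deg t = d + a} \<union> mon ` high_pps m (Suc k) (d + a))"
  using p
proof (induction a arbitrary: p d)
  case 0
  then show ?case by simp
next
  case (Suc a)
  let ?T = "{v. v + Poly_Mapping.single k a \<in> T}"
  have T: "?T \<subseteq> pps m" "stable_pps ?T"
    using pps_add_subset[OF _ \<open>T \<subseteq> pps m\<close>] stable_pps_colon[OF \<open>stable_pps T\<close>] by auto
  have "var k * p \<in> mpoly.span (dist_pp m M ` {v \<in> ?T. pp_deg v = d + 1} \<union> mon ` high_pps m (Suc k) (d + 1))"
    (is "_ \<in> mpoly.span ?B")
    using Suc.prems
  proof (rule mult_in_span)
    fix b assume "b \<in> dist_pp m M ` {v. v + Poly_Mapping.single k (Suc a) \<in> T \<and> pp_deg v = d} \<union>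
      mon ` high_pps m (Suc k) d"
    then consider v where "v + Poly_Mapping.single k (Suc a) \<in> T" "pp_deg v = d" "b = dist_pp m M v"
      | u where "u \<in> high_pps m (Suc k) d" "b = mon u" by auto
    then show "var k * b \<in> mpoly.span ?B"
    proof cases
      case 1
      have "v + Poly_Mapping.single k (Suc a) = v + unit_pp k + Poly_Mapping.single k a"
        by (simp add: add.assoc plus_1_eq_Suc flip: single_add)
      then have "v + unit_pp k \<in> ?T" using 1(1) by simp
      from var_mult_dist_pp_stable[OF M \<open>k < m\<close> T this] show ?thesis using 1 by simp
    next
      case 2
      then have "unit_pp k + u \<in> high_pps m (Suc k) (d + 1)"
        using \<open>k < m\<close> by (auto simp: keys_add_nat pp_deg_add)
      then show ?thesis using 2(2) by (auto simp: var_mon intro!: mpoly.span_base)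
    qed
  qed
  from Suc.IH[of "var k * p" "d + 1"] this show ?case
    by (simp add: ac_simps power_Suc2 plus_1_eq_Suc)
qed

text \<open>Induction on the number \<open>k\<close> of variables allowed in \<open>T\<close>, while
  the ring keeps all \<open>m\<close>. Split the power of the last allowed variable off
  \<open>t\<close>, take \<open>f\<close> for the rest \<open>u\<close>, multiply by that power, and
  discard the part in later variables.\<close>

lemma stable_pps_leading:
  assumes M: "flag_generic m M" and "k \<le> m" "T \<subseteq> pps k" "stable_pps T" "t \<in> T"
  shows "\<exists>f \<in> mpoly.span (dist_pp m M ` {v \<in> T. pp_deg v = pp_deg t}).
    f - mon t \<in> supported {u \<in> pps_of_deg m (pp_deg t). drl_less u t}"
  using assms(2-)
proof (induction k arbitrary: T t)
  case 0
  then have "t = 0" by auto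
  then show ?case
    using 0 by (intro bexI[of _ 1] mpoly.span_base) (auto simp: supported_def intro: image_eqI[of _ _ 0])
next
  case (Suc k)
  define a where "a = lookup t k"
  define u where "u = t - Poly_Mapping.single k a"
  let ?x = "Poly_Mapping.single k a"
  have "t = ?x + u" unfolding u_def
    by (rule pp_diff_add) (auto simp: lookup_single when_def a_def)
  then have t: "t = u + ?x" by (simp add: add.commute)
  have "u \<in> pps k"
  proof -
    have "k \<notin> keys u" by (simp add: in_keys_iff u_def lookup_minus a_def)
    moreover have "u \<in> pps (Suc k)"
      using Suc.prems(4) unfolding t by (rule pps_add_subset) (rule Suc.prems(2))
    ultimately show ?thesis by (auto simp: less_Suc_eq subset_iff)
  qed
  have Tm: "T \<subseteq> pps m" using Suc.prems by fastforce
  \<comment> \<open>The cofactors of \<open>?x\<close> in \<open>T\<close> that avoid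
    \<open>var k\<close>: again stable and in one variable less, so that the induction hypothesis
    applies to \<open>u\<close>.\<close>
  let ?T = "{v \<in> {v. v + ?x \<in> T}. keys v \<subseteq> {..<k}}"
  have "stable_pps ?T" by (intro stable_pps_restrict stable_pps_colon Suc.prems)
  moreover have "u \<in> ?T" using Suc.prems t \<open>u \<in> pps k\<close> by auto
  ultimately obtain f where f: "f \<in> mpoly.span (dist_pp m M ` {v \<in> ?T. pp_deg v = pp_deg u})"
    "f - mon u \<in> supported {w \<in> pps_of_deg m (pp_deg u). drl_less w u}"
    using Suc.IH[of ?T u] Suc.prems(1) by auto
  have "f \<in> mpoly.span (dist_pp m M ` {v. v + ?x \<in> T \<and> pp_deg v = pp_deg u} \<union>
      mon ` high_pps m (Suc k) (pp_deg u))"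
    using f(1) by (rule rev_subsetD[OF _ mpoly.span_mono]) auto
  then have "var k ^ a * f \<in> mpoly.span (dist_pp m M ` {v \<in> T. pp_deg v = pp_deg u + a} \<union>
      mon ` high_pps m (Suc k) (pp_deg u + a))"
    using Suc.prems by (intro var_power_mult_dist_pp_stable[OF M _ Tm]) auto
  moreover have deg: "pp_deg u + a = pp_deg t" by (simp add: t pp_deg_add)
  \<comment> \<open>\<open>g\<close> is the required element; every term of \<open>h\<close>
    involves a variable after \<open>var k\<close>.\<close>
  ultimately obtain g h where gh: "var k ^ a * f = g + h"
    "g \<in> mpoly.span (dist_pp m M ` {v \<in> T. pp_deg v = pp_deg t})"
    "h \<in> supported (high_pps m (Suc k) (pp_deg t))"
    unfolding mpoly.span_Un supported_eq_span by auto
  have "mon ?x * f = g + h" using gh(1) by (simp only: var_power)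
  moreover have "mon ?x * mon u = (mon t :: (nat, 'a) mpoly)"
    by (simp only: t mon_add mult.commute)
  ultimately have eq: "g - mon t = mon ?x * (f - mon u) - h"
    by (simp add: right_diff_distrib)
  have "mon ?x * (f - mon u) \<in> supported {w \<in> pps_of_deg m (pp_deg t). drl_less w t}"
    using f(2)
  proof (rule supported_mult[of _ "{?x}", rotated])
    fix s w assume s: "s \<in> {?x}" and w: "w \<in> {w \<in> pps_of_deg m (pp_deg u). drl_less w u}"
    have "drl_less (?x + w) (?x + u)" using w by (intro drl_less_add_left) auto
    moreover have "keys (?x + w) \<subseteq> {..<m}" using w Suc.prems(1) by (auto simp: keys_add_nat)
    ultimately show "s + w \<in> {w \<in> pps_of_deg m (pp_deg t). drl_less w t}"
      using s w by (auto simp: pp_deg_add t add.commute)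
  qed simp
  \<comment> \<open>\<open>t\<close> lives in the first \<open>Suc k\<close> variables, while each
    term of \<open>h\<close> has a later one and is therefore smaller.\<close>
  moreover have "h \<in> supported {w \<in> pps_of_deg m (pp_deg t). drl_less w t}"
  proof (rule rev_subsetD[OF gh(3) supported_mono])
    have "keys t \<subseteq> {..<Suc k}" using Suc.prems by auto
    then show "high_pps m (Suc k) (pp_deg t) \<subseteq> {w \<in> pps_of_deg m (pp_deg t). drl_less w t}"
      using drl_less_higher_variable[of t "Suc k"] by auto
  qed
  ultimately have "g - mon t \<in> supported {w \<in> pps_of_deg m (pp_deg t). drl_less w t}"
    unfolding eq by (rule mpoly.subspace_diff[OF subspace_supported])
  then show ?case using gh(2) by blast
qed

lemma leading_pps_distraction:
  assumes M: "flag_generic m M" and T: "T \<subseteq> pps m" "stable_pps T"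
  shows "{t. \<exists>p \<in> mpoly.span (dist_pp m M ` T). is_leading_pp p t} = T"
proof -
  have lin: "\<And>i j. i < m \<Longrightarrow> M i j \<in> linear_forms m" using M by (simp add: flag_generic_def)
  have "\<exists>f \<in> mpoly.span (dist_pp m M ` {v \<in> T. pp_deg v = pp_deg t}). is_leading_pp f t"
    if t: "t \<in> T" for t
  proof -
    obtain f where f: "f \<in> mpoly.span (dist_pp m M ` {v \<in> T. pp_deg v = pp_deg t})"
      "f - mon t \<in> supported {u \<in> pps_of_deg m (pp_deg t). drl_less u t}"
      using stable_pps_leading[OF M order_refl T t] by blast
    have keys_t: "t \<notin> keys (f - mon t)" using f(2) drl_less_irrefl[of t] by (auto simp: supported_def)
    have "lookup (f - mon t) t = lookup f t - 1" by (simp add: lookup_minus lookup_mon)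
    then have "t \<in> keys f" using keys_t by (simp add: in_keys_iff)
    moreover have "drl_less s t" if "s \<in> keys f" "s \<noteq> t" for s
    proof -
      have "lookup (f - mon t) s = lookup f s" using that by (simp add: lookup_minus lookup_mon)
      then have "s \<in> keys (f - mon t)" using that by (simp add: in_keys_iff)
      then show ?thesis using f(2) by (auto simp: supported_def)
    qed
    ultimately have "is_leading_pp f t" by (simp add: is_leading_pp_def)
    then show ?thesis using f(1) by blast
  qed
  then obtain f where f: "\<And>t. t \<in> T \<Longrightarrow> f t \<in> mpoly.span (dist_pp m M ` {v \<in> T. pp_deg v = pp_deg t})"
    "\<And>t. t \<in> T \<Longrightarrow> is_leading_pp (f t) t"
    unfolding Bex_def by metis
  show ?thesis
  proof (intro equalityI subsetI)
    fix t assume "t \<in> T"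
    then show "t \<in> {t. \<exists>p \<in> mpoly.span (dist_pp m M ` T). is_leading_pp p t}"
      using f[of t] mpoly.span_mono[of "dist_pp m M ` {v \<in> T. pp_deg v = pp_deg t}" "dist_pp m M ` T"] by blast
  next
    fix t0 assume "t0 \<in> {t. \<exists>p \<in> mpoly.span (dist_pp m M ` T). is_leading_pp p t}"
    then obtain q where q: "q \<in> supported T" and lead: "is_leading_pp (distraction m M q) t0"
      unfolding distraction_image[symmetric] by auto
    show "t0 \<in> T"
    proof (rule ccontr)
      assume t0: "t0 \<notin> T"
      let ?d = "pp_deg t0"
      define A where "A = {t \<in> T. pp_deg t = ?d}"
      have finA: "finite A"
        by (rule finite_subset[OF _ finite_pps_deg[of m ?d]]) (use T in \<open>auto simp: A_def\<close>)
      \<comment> \<open>The component of \<open>distraction m M q\<close> in the degree of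
        \<open>t0\<close>. Since D preserves degrees, it only involves the terms of \<open>q\<close>
        in \<open>A\<close>, and it still leads with \<open>t0\<close>.\<close>
      define p where "p = (\<Sum>t\<in>keys q. if pp_deg t = ?d then scale (lookup q t) (dist_pp m M t) else 0)"
      have D: "lookup (dist_pp m M t) u = 0" if "t \<in> keys q" "pp_deg t \<noteq> pp_deg u" for t u
      proof -
        have "t \<in> pps m" using that(1) q T(1) by (auto simp: supported_def)
        then have "dist_pp m M t \<in> supported (pps_of_deg m (pp_deg t))"
          by (intro dist_pp_supported lin)
        then show ?thesis using that(2)
          by (auto simp: supported_def in_keys_iff)
      qed
      have lookup_p: "lookup p u = (\<Sum>t\<in>keys q. if pp_deg t = ?d then lookup q t * lookup (dist_pp m M t) u else 0)" for u
        unfolding p_def lookup_sum by (rule sum.cong) (auto simp: lookup_scale)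
      have lp: "lookup p u = (if pp_deg u = ?d then lookup (distraction m M q) u else 0)" for u
      proof (cases "pp_deg u = ?d")
        case True
        then show ?thesis
          unfolding lookup_p distraction_superset[OF finite_keys order_refl] lookup_sum
          by (auto simp: lookup_scale D intro!: sum.cong)
      next
        case False
        then show ?thesis unfolding lookup_p by (auto simp: D intro!: sum.neutral)
      qed
      have "keys p \<subseteq> keys (distraction m M q)"
        by (auto simp: in_keys_iff lp split: if_splits)
      moreover have "t0 \<in> keys p"
        using lead by (simp add: is_leading_pp_def in_keys_iff lp)
      ultimately have leadp: "is_leading_pp p t0"
        using lead by (auto simp: is_leading_pp_def)
      have p: "p \<in> mpoly.span (dist_pp m M ` A)"
        unfolding p_def
      proof (rule mpoly.span_sum)
        fix t assume "t \<in> keys q"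
        then have "pp_deg t = ?d \<Longrightarrow> t \<in> A" using q by (auto simp: supported_def A_def)
        then show "(if pp_deg t = ?d then scale (lookup q t) (dist_pp m M t) else 0)
            \<in> mpoly.span (dist_pp m M ` A)"
          by (simp add: mpoly.span_scale mpoly.span_base mpoly.span_zero)
      qed
      \<comment> \<open>With \<open>t0\<close> outside \<open>T\<close>, this gives
        \<open>card A\<close> + 1 elements with distinct leading power products, hence independent,
        in a space spanned by at most \<open>card A\<close> elements.\<close>
      define F where "F = (\<lambda>t. if t = t0 then p else f t)"
      have lead_F: "is_leading_pp (F t) t" if "t \<in> insert t0 A" for t
        using that leadp f(2)[of t] by (auto simp: F_def A_def)
      have "finite (insert t0 A)" using finA by simp
      note ind = independent_leading_pps[OF this lead_F]
      have "F t \<in> mpoly.span (dist_pp m M ` A)" if "t \<in> insert t0 A" for t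
        using that p f(1)[of t] by (auto simp: F_def A_def)
      then have "F ` insert t0 A \<subseteq> mpoly.span (dist_pp m M ` A)" by blast
      then have "card (F ` insert t0 A) \<le> card (dist_pp m M ` A)"
        using mpoly.independent_span_bound[OF finite_imageI[OF finA] ind(2)] by blast
      also have "\<dots> \<le> card A" using finA by (rule card_image_le)
      finally show False
        using ind(1) finA t0 by (simp add: card_image A_def)
    qed
  qed
qed

section \<open>Generic coordinates\<close>

lemma comm_ring_hom_GL_act: "comm_ring_hom (GL_act m g)"
  unfolding GL_act_def by (intro comm_ring_hom_poly_hom comm_ring_hom_const)

lemma GL_act_scale: "GL_act m g (scale c p) = scale c (GL_act m g p)"
  unfolding GL_act_def by (simp add: poly_hom_scale[OF comm_ring_hom_const]) (simp add: scale_def)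

text \<open>A coordinate change is a ring homomorphism, so it turns distractions into those of the
  transformed matrix, to which \<open>flag_generic\<close> will apply.\<close>

lemma GL_act_dist_pp:
  "GL_act m g (dist_pp m L t) = dist_pp m (\<lambda>i j. GL_act m g (L i j)) t"
proof -
  interpret comm_ring_hom "GL_act m g" by (rule comm_ring_hom_GL_act)
  show ?thesis by (simp add: dist_pp_def hom_prod)
qed

lemma GL_act_span_dist_pp:
  "GL_act m g ` mpoly.span (dist_pp m L ` T) =
    mpoly.span (dist_pp m (\<lambda>i j. GL_act m g (L i j)) ` T)"
proof -
  interpret comm_ring_hom "GL_act m g" by (rule comm_ring_hom_GL_act)
  show ?thesis
    by (subst image_span_linear) (simp_all add: hom_add GL_act_scale image_image GL_act_dist_pp)
qed

lemma unit_pp_eq_iff [simp]: "unit_pp i = unit_pp j \<longleftrightarrow> i = j"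
  by (metis keys_single singleton_inject zero_neq_one)

lemma linear_form_expand:
  assumes "p \<in> linear_forms m"
  shows "p = (\<Sum>i<m. scale (lookup p (unit_pp i)) (var i))"
proof -
  have "p = (\<Sum>t\<in>unit_pp ` {..<m}. scale (lookup p t) (mon t))"
  proof (rule mpoly_eq_sum)
    show "keys p \<subseteq> unit_pp ` {..<m}"
      using assms by (auto simp: linear_forms_supported supported_def elim!: pp_deg_1E)
  qed simp
  then show ?thesis
    by (subst (asm) sum.reindex) (auto simp: inj_on_def var_def)
qed

lemma lookup_var_unit: "lookup (var i) (unit_pp r) = (if r = i then 1 else 0)"
  by (auto simp: var_def lookup_mon)

lemma GL_act_linear_form:
  assumes "p \<in> linear_forms m"
  shows "GL_act m g p \<in> linear_forms m"
    and "r < m \<Longrightarrow> lookup (GL_act m g p) (unit_pp r) = (\<Sum>c<m. lookup p (unit_pp c) * g $$ (r, c))"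
proof -
  interpret comm_ring_hom "GL_act m g" by (rule comm_ring_hom_GL_act)
  have var: "GL_act m g (var c) = (\<Sum>i<m. scale (g $$ (i, c)) (var i))" for c
    unfolding GL_act_def by (rule poly_hom_var[OF comm_ring_hom_const])
  have eq: "GL_act m g p = (\<Sum>c<m. scale (lookup p (unit_pp c)) (\<Sum>i<m. scale (g $$ (i, c)) (var i)))"
    by (subst linear_form_expand[OF assms]) (simp add: hom_sum GL_act_scale var)
  show "GL_act m g p \<in> linear_forms m"
    unfolding eq linear_forms_eq
    by (intro mpoly.span_sum mpoly.span_scale mpoly.span_base) auto
  show "lookup (GL_act m g p) (unit_pp r) = (\<Sum>c<m. lookup p (unit_pp c) * g $$ (r, c))" if "r < m"
    using that by (simp add: eq lookup_sum lookup_scale lookup_var_unit if_distrib cong: if_cong)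
qed

section \<open>Genericity as nonvanishing of minors\<close>

lemma right_inverse_of_det:
  fixes A :: "'k::field mat"
  assumes "A \<in> carrier_mat n n" "det A \<noteq> 0"
  obtains B where "B \<in> carrier_mat n n" "A * B = 1\<^sub>m n" "B * A = 1\<^sub>m n"
proof -
  from det_non_zero_imp_unit[OF assms] show ?thesis
    using that by (auto simp: Units_def ring_mat_def)
qed

text \<open>The leading principal minor of size \<open>k\<close> + 1 of the product of
  \<open>g\<close> with the matrix \<open>coeff_mat m L js\<close> below, as a polynomial in the
  entries of \<open>g\<close>; the variable \<open>(r, c)\<close> stands for the entry in row
  \<open>r\<close> and column \<open>c\<close>.\<close>

definition minor_poly ::
  "nat \<Rightarrow> (nat \<Rightarrow> nat \<Rightarrow> (nat, 'k::field) mpoly) \<Rightarrow> (nat \<Rightarrow> nat) \<Rightarrow> nat \<Rightarrow> (nat \<times> nat, 'k) mpoly" where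
  "minor_poly m L js k = det (mat (Suc k) (Suc k)
    (\<lambda>(r, i). \<Sum>c<m. const (lookup (L i (js i)) (unit_pp c)) * var (r, c)))"

lemma eval_minor_poly:
  assumes "k < m" "\<And>i. i < m \<Longrightarrow> L i (js i) \<in> linear_forms m"
  shows "eval (\<lambda>ij. g $$ ij) (minor_poly m L js k) =
    det (mat (Suc k) (Suc k) (\<lambda>(r, i). lookup (GL_act m g (L i (js i))) (unit_pp r)))"
proof -
  let ?e = "eval (\<lambda>ij. g $$ ij) :: (nat \<times> nat, 'a) mpoly \<Rightarrow> 'a"
  interpret comm_ring_hom ?e by (rule comm_ring_hom_poly_hom[OF comm_ring_hom_id])
  show ?thesis
    unfolding minor_poly_def hom_det[symmetric]
    by (rule arg_cong[where f = det], rule eq_matI)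
      (use assms in \<open>auto simp: hom_sum hom_mult poly_hom_const[OF comm_ring_hom_id]
        poly_hom_var[OF comm_ring_hom_id] GL_act_linear_form\<close>)
qed

lemma subspace_polys_over: "mpoly.subspace (polys_over V)"
  unfolding polys_over_eq by (rule subspace_supported)

lemma polys_over_simps:
  "1 \<in> polys_over V" "const c \<in> polys_over V" "i \<in> V \<Longrightarrow> var i \<in> polys_over V"
  by (auto simp: polys_over_eq supported_def const_def var_def)

lemma polys_over_prod: "(\<And>x. x \<in> A \<Longrightarrow> f x \<in> polys_over V) \<Longrightarrow> prod f A \<in> polys_over V"
  by (induction A rule: infinite_finite_induct) (auto simp: polys_over_simps intro: polys_over_closed)

lemma det_in_polys_over:
  assumes "A \<in> carrier_mat n n" "\<And>i j. i < n \<Longrightarrow> j < n \<Longrightarrow> A $$ (i, j) \<in> polys_over V"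
  shows "det A \<in> polys_over V"
  unfolding det_def'[OF assms(1)]
proof (rule mpoly.subspace_sum[OF subspace_polys_over])
  fix p assume p: "p \<in> {p. p permutes {0..<n}}"
  have "(\<Prod>i = 0..<n. A $$ (i, p i)) \<in> polys_over V"
  proof (rule polys_over_prod)
    fix i assume "i \<in> {0..<n}"
    then show "A $$ (i, p i) \<in> polys_over V"
      using p permutes_in_image[of p "{0..<n}" i] by (intro assms(2)) auto
  qed
  then show "signof p * (\<Prod>i = 0..<n. A $$ (i, p i)) \<in> polys_over V"
    by (auto simp: sign_def intro: polys_over_closed)
qed

lemma minor_poly_in_polys_over:
  assumes "k < m"
  shows "minor_poly m L js k \<in> polys_over ({..<m} \<times> {..<m})"
  unfolding minor_poly_def
  by (rule det_in_polys_over)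
    (use assms in \<open>auto intro!: mpoly.subspace_sum[OF subspace_polys_over] polys_over_closed polys_over_simps\<close>)

lemma eval_cong:
  assumes "\<And>v. v \<in> V \<Longrightarrow> a v = b v" "p \<in> polys_over V"
  shows "eval a p = eval b p"
proof -
  have "a v = b v" if "t \<in> keys p" "v \<in> keys t" for t v
    using that assms by (auto simp: polys_over_def)
  then show ?thesis unfolding poly_hom_def by (simp cong: sum.cong prod.cong)
qed

lemma poly_poly_hom:
  "poly (poly_hom (\<lambda>c. [:c:]) \<phi> f) s = eval (\<lambda>v. poly (\<phi> v) s) f"
  by (simp add: poly_hom_def poly_sum poly_prod)

text \<open>
  Two nonvanishing points are joined by a line, on which each polynomial restricts to a nonzero
  univariate one.
\<close>
lemma common_nonvanishing_point:
  assumes "infinite (UNIV :: 'k::field set)" "finite F"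
    and "\<And>f :: ('v, 'k) mpoly. f \<in> F \<Longrightarrow> \<exists>a. eval a f \<noteq> 0"
  shows "\<exists>a. \<forall>f\<in>F. eval a f \<noteq> 0"
  using assms(2,3)
proof (induction F rule: finite_induct)
  case (insert f0 F)
  then obtain a where a: "\<forall>f\<in>F. eval a f \<noteq> 0" by (metis insertCI)
  obtain b where b: "eval b f0 \<noteq> 0" using insert.prems by blast
  \<comment> \<open>\<open>q f\<close> is \<open>f\<close> restricted to the line through
    \<open>a\<close> (parameter 0) and \<open>b\<close> (parameter 1).\<close>
  define q :: "('v, 'k) mpoly \<Rightarrow> 'k poly" where
    "q = poly_hom (\<lambda>c. [:c:]) (\<lambda>v. [:a v, b v - a v:])"
  have q: "poly (q f) s = eval (\<lambda>v. a v + s * (b v - a v)) f" for f s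
    unfolding q_def poly_poly_hom by simp
  have "q f \<noteq> 0" if "f \<in> insert f0 F" for f
  proof
    assume "q f = 0"
    then show False using that a b q[of f 0] q[of f 1] by auto
  qed
  then have "finite (\<Union>f\<in>insert f0 F. {s. poly (q f) s = 0})"
    using insert.hyps(1) by (intro finite_UN_I poly_roots_finite) auto
  then obtain s where "s \<notin> (\<Union>f\<in>insert f0 F. {s. poly (q f) s = 0})"
    using assms(1) by (metis ex_new_if_finite)
  then show ?case using q by auto
qed simp

text \<open>An invertible minor allows the chosen entries of the first \<open>k\<close> + 1 rows to
  be combined, by column \<open>k\<close> of the inverse, to a form that agrees with
  \<open>var k\<close> in the first \<open>k\<close> + 1 coefficients and so differs from it only in
  later variables.\<close>

lemma flag_generic_of_minors:
  assumes lin: "\<And>i j. i < m \<Longrightarrow> M i j \<in> linear_forms m"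
    and det: "\<And>k js. k < m \<Longrightarrow>
      det (mat (Suc k) (Suc k) (\<lambda>(r, i). lookup (M i (js i)) (unit_pp r))) \<noteq> 0"
  shows "flag_generic m M"
  unfolding flag_generic_def
proof (intro conjI allI impI lin)
  fix k js assume "k < m"
  let ?A = "mat (Suc k) (Suc k) (\<lambda>(r, i). lookup (M i (js i)) (unit_pp r))"
  obtain B where B: "B \<in> carrier_mat (Suc k) (Suc k)" "?A * B = 1\<^sub>m (Suc k)"
    by (rule right_inverse_of_det[OF _ det[OF \<open>k < m\<close>, of js], of "Suc k"]) auto
  have AB: "(\<Sum>i\<le>k. lookup (M i (js i)) (unit_pp r) * B $$ (i, k)) = (if r = k then 1 else 0)"
    if "r \<le> k" for r
  proof -
    have "(?A * B) $$ (r, k) = (\<Sum>i\<le>k. lookup (M i (js i)) (unit_pp r) * B $$ (i, k))"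
      using that B(1) by (simp add: scalar_prod_def atLeast0LessThan flip: lessThan_Suc_atMost)
    then show ?thesis using that B(2) by simp
  qed
  define p where "p = (\<Sum>i\<le>k. scale (B $$ (i, k)) (M i (js i)))"
  have p: "p \<in> linear_forms m"
    unfolding p_def linear_forms_supported
    by (intro mpoly.subspace_sum mpoly.subspace_scale subspace_supported)
      (use lin \<open>k < m\<close> in \<open>auto simp: linear_forms_supported\<close>)
  have "lookup p (unit_pp r) = (\<Sum>i\<le>k. lookup (M i (js i)) (unit_pp r) * B $$ (i, k))" for r
    by (simp add: p_def lookup_sum lookup_scale mult.commute)
  then have low: "lookup p (unit_pp r) = (if r = k then 1 else 0)" if "r \<le> k" for r
    using AB that by simp
  have below: "{..<m} = insert k ({..<k} \<union> {k<..<m})" using \<open>k < m\<close> by auto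
  have "p = (\<Sum>r<m. scale (lookup p (unit_pp r)) (var r))"
    by (rule linear_form_expand[OF p])
  also have "\<dots> = scale (lookup p (unit_pp k)) (var k) +
      (\<Sum>r\<in>{..<k} \<union> {k<..<m}. scale (lookup p (unit_pp r)) (var r))"
    unfolding below by (rule sum.insert) auto
  also have "(\<Sum>r\<in>{..<k} \<union> {k<..<m}. scale (lookup p (unit_pp r)) (var r)) =
      (\<Sum>r<k. scale (lookup p (unit_pp r)) (var r)) +
      (\<Sum>r\<in>{k<..<m}. scale (lookup p (unit_pp r)) (var r))"
    by (rule sum.union_disjoint) auto
  also have "(\<Sum>r<k. scale (lookup p (unit_pp r)) (var r)) = 0"
    by (intro sum.neutral) (simp add: low)
  finally have "p = var k + (\<Sum>r\<in>{k<..<m}. scale (lookup p (unit_pp r)) (var r))"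
    by (simp add: low)
  then have "var k = p - (\<Sum>r\<in>{k<..<m}. scale (lookup p (unit_pp r)) (var r))"
    by (simp only: eq_diff_eq)
  also have "\<dots> \<in> mpoly.span ((\<lambda>i. M i (js i)) ` {..k} \<union> var ` {k<..<m})"
    unfolding p_def
    by (intro mpoly.span_diff mpoly.span_sum mpoly.span_scale mpoly.span_base) auto
  finally show "var k \<in> mpoly.span ((\<lambda>i. M i (js i)) ` {..k} \<union> var ` {k<..<m})" .
qed

definition coeff_mat :: "nat \<Rightarrow> (nat \<Rightarrow> nat \<Rightarrow> (nat, 'k::field) mpoly) \<Rightarrow> (nat \<Rightarrow> nat) \<Rightarrow> 'k mat" where
  "coeff_mat m L js = mat m m (\<lambda>(c, i). lookup (L i (js i)) (unit_pp c))"

text \<open>The spanning condition on \<open>L\<close> writes each variable as a combination of the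
  entries chosen by \<open>js\<close>. The coefficients form a right inverse, which for square
  matrices is also a left inverse.\<close>

lemma coeff_mat_inverse:
  assumes L: "distraction_matrix m L"
  obtains B where "B \<in> carrier_mat m m" "coeff_mat m L js * B = 1\<^sub>m m" "B * coeff_mat m L js = 1\<^sub>m m"
proof -
  have "\<exists>b. var r = (\<Sum>i<m. scale (b i) (L i (js i)))" if "r < m" for r
  proof -
    have "var r \<in> mpoly.span ((\<lambda>i. L i (js i)) ` {..<m})"
      using distraction_matrixD(2)[OF L] var_in_linear_forms[OF that] by simp
    then show ?thesis by (simp add: span_image_sum)
  qed
  then obtain b where b: "\<And>r. r < m \<Longrightarrow> var r = (\<Sum>i<m. scale (b r i) (L i (js i)))" by metis
  define B where "B = mat m m (\<lambda>(i, r). b r i)"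
  have "coeff_mat m L js * B = 1\<^sub>m m"
  proof (rule eq_matI)
    fix c r assume cr: "c < dim_row (1\<^sub>m m :: 'a mat)" "r < dim_col (1\<^sub>m m :: 'a mat)"
    then have "(coeff_mat m L js * B) $$ (c, r) = (\<Sum>i<m. b r i * lookup (L i (js i)) (unit_pp c))"
      by (auto simp: coeff_mat_def B_def scalar_prod_def mult.commute atLeast0LessThan intro!: sum.cong)
    also have "\<dots> = lookup (var r) (unit_pp c)"
      using cr by (simp add: b lookup_sum lookup_scale)
    finally show "(coeff_mat m L js * B) $$ (c, r) = 1\<^sub>m m $$ (c, r)"
      using cr by (simp add: lookup_var_unit)
  qed (simp_all add: coeff_mat_def B_def)
  moreover have "B \<in> carrier_mat m m" "coeff_mat m L js \<in> carrier_mat m m"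
    by (simp_all add: B_def coeff_mat_def)
  ultimately show ?thesis using that mat_mult_left_right_inverse by blast
qed

text \<open>The inverse of \<open>coeff_mat m L js\<close> is a coordinate change that turns the
  chosen entries into the variables themselves, so that the minor is that of an identity
  matrix.\<close>

lemma minor_poly_nonvanishing:
  assumes L: "distraction_matrix m L" and "k < m"
  shows "\<exists>a. eval a (minor_poly m L js k) \<noteq> 0"
proof -
  obtain B where B: "B \<in> carrier_mat m m" "B * coeff_mat m L js = 1\<^sub>m m"
    using coeff_mat_inverse[OF L] .
  have "lookup (GL_act m B (L i (js i))) (unit_pp r) = (if r = i then 1 else 0)" if "i < m" "r < m" for i r
  proof -
    have "lookup (GL_act m B (L i (js i))) (unit_pp r) = (\<Sum>c<m. lookup (L i (js i)) (unit_pp c) * B $$ (r, c))"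
      using that by (intro GL_act_linear_form distraction_matrixD(1)[OF L])
    also have "\<dots> = (B * coeff_mat m L js) $$ (r, i)"
      using that B(1) by (auto simp: coeff_mat_def scalar_prod_def mult.commute atLeast0LessThan intro!: sum.cong)
    finally show ?thesis using that B(2) by simp
  qed
  then have "mat (Suc k) (Suc k) (\<lambda>(r, i). lookup (GL_act m B (L i (js i))) (unit_pp r)) = 1\<^sub>m (Suc k)"
    using \<open>k < m\<close> by (intro eq_matI) auto
  then have "eval (\<lambda>ij. B $$ ij) (minor_poly m L js k) = 1"
    using \<open>k < m\<close> by (subst eval_minor_poly) (simp_all add: distraction_matrixD(1)[OF L])
  then show ?thesis by (metis zero_neq_one)
qed

text \<open>The generic determinant will join the minors, so that a common nonvanishing point is an
  invertible matrix.\<close>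

lemma det_var_mat:
  fixes g :: "'k::field mat"
  shows "det (mat m m var) \<in> polys_over ({..<m} \<times> {..<m})"
    "g \<in> carrier_mat m m \<Longrightarrow> eval (\<lambda>ij. g $$ ij) (det (mat m m var)) = det g"
proof -
  show "det (mat m m var) \<in> polys_over ({..<m} \<times> {..<m})"
    by (rule det_in_polys_over[of _ m]) (auto intro: polys_over_simps)
  assume g: "g \<in> carrier_mat m m"
  interpret comm_ring_hom "eval (\<lambda>ij. g $$ ij) :: (nat \<times> nat, 'k) mpoly \<Rightarrow> 'k"
    by (rule comm_ring_hom_poly_hom[OF comm_ring_hom_id])
  have "map_mat (eval (\<lambda>ij. g $$ ij)) (mat m m var) = g"
    using g by (intro eq_matI) (auto simp: poly_hom_var[OF comm_ring_hom_id])
  then show "eval (\<lambda>ij. g $$ ij) (det (mat m m var)) = det g" by (simp flip: hom_det)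
qed

text \<open>The rows of \<open>L\<close> are eventually constant, so there are only finitely many
  minors to avoid; the nonvanishing locus of their product with the determinant is the open set, and
  it is nonempty because the field is infinite.\<close>

lemma generic_flag:
  assumes K: "infinite (UNIV :: 'k::field set)" and L: "distraction_matrix m (L :: nat \<Rightarrow> nat \<Rightarrow> (nat, 'k) mpoly)"
  shows "\<exists>U. zariski_open_GL m U \<and> U \<noteq> {} \<and> (\<forall>g\<in>U. flag_generic m (\<lambda>i j. GL_act m g (L i j)))"
proof -
  obtain N where N: "\<And>i j. i < m \<Longrightarrow> j > N \<Longrightarrow> L i j = L i N"
    using L unfolding distraction_matrix_def by metis
  let ?J = "\<Pi>\<^sub>E i\<in>{..<m}. {..N}"
  define F where "F = insert (det (mat m m var)) (\<Union>js\<in>?J. minor_poly m L js ` {..<m})"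
  have "finite ?J" by (rule finite_PiE) simp_all
  then have finF: "finite F" by (simp add: F_def)
  have F_cases: thesis if "h \<in> F" "h = det (mat m m var) \<Longrightarrow> thesis"
    "\<And>js k. k < m \<Longrightarrow> h = minor_poly m L js k \<Longrightarrow> thesis" for h thesis
  proof -
    from \<open>h \<in> F\<close> show thesis
      unfolding F_def
    proof (elim insertE UN_E imageE)
    qed (use that(2,3) in simp_all)
  qed
  have F_over: "F \<subseteq> polys_over ({..<m} \<times> {..<m})"
  proof
    fix h assume "h \<in> F"
    then show "h \<in> polys_over ({..<m} \<times> {..<m})"
      by (rule F_cases) (simp_all only: det_var_mat(1) minor_poly_in_polys_over)
  qed
  define f where "f = \<Prod>F"
  have f_over: "f \<in> polys_over ({..<m} \<times> {..<m})"
    unfolding f_def by (rule polys_over_prod) (use F_over in auto)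
  have eval_f: "eval a f \<noteq> 0 \<longleftrightarrow> (\<forall>h\<in>F. eval a h \<noteq> 0)" for a
  proof -
    interpret comm_ring_hom "eval a :: (nat \<times> nat, 'k) mpoly \<Rightarrow> 'k"
      by (rule comm_ring_hom_poly_hom[OF comm_ring_hom_id])
    show ?thesis using finF by (simp add: f_def hom_prod)
  qed
  define U where "U = {g \<in> general_linear m. eval (\<lambda>ij. g $$ ij) f \<noteq> 0}"
  have "zariski_open_GL m U"
    unfolding zariski_open_GL_def using f_over by (intro exI[of _ "{f}"]) (auto simp: U_def)
  moreover have "U \<noteq> {}"
  proof -
    have "\<exists>a. eval a h \<noteq> 0" if "h \<in> F" for h
      using that
    proof (rule F_cases)
      assume "h = det (mat m m var)"
      then have "eval (\<lambda>ij. 1\<^sub>m m $$ ij) h = 1" using det_var_mat(2)[of "1\<^sub>m m" m] by simp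
      then show ?thesis by (metis zero_neq_one)
    qed (use minor_poly_nonvanishing[OF L] in simp)
    then obtain a where a: "\<forall>h\<in>F. eval a h \<noteq> 0"
      using common_nonvanishing_point[OF K finF] by blast
    define g where "g = mat m m a"
    have g: "g \<in> carrier_mat m m" by (simp add: g_def)
    have eval_g: "eval (\<lambda>ij. g $$ ij) h = eval a h" if "h \<in> polys_over ({..<m} \<times> {..<m})" for h
      by (rule eval_cong[OF _ that]) (auto simp: g_def)
    have "det g = eval a (det (mat m m var))"
      using det_var_mat(2)[OF g] eval_g[OF det_var_mat(1)] by simp
    then have "det g \<noteq> 0" using a by (simp add: F_def)
    then obtain B where "B \<in> carrier_mat m m" "g * B = 1\<^sub>m m" "B * g = 1\<^sub>m m"
      using right_inverse_of_det[OF g] by blast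
    then have "invertible_mat g"
      using g unfolding invertible_mat_def inverts_mat_def by auto
    moreover have "eval a f \<noteq> 0" using a by (simp only: eval_f)
    ultimately have "g \<in> U"
      using g by (simp add: U_def general_linear_def eval_g[OF f_over])
    then show ?thesis by blast
  qed
  moreover have "flag_generic m (\<lambda>i j. GL_act m g (L i j))" if "g \<in> U" for g
  proof (rule flag_generic_of_minors)
    show "GL_act m g (L i j) \<in> linear_forms m" if "i < m" for i j
      using that by (intro GL_act_linear_form distraction_matrixD(1)[OF L])
    fix k and js :: "nat \<Rightarrow> nat" assume "k < m"
    \<comment> \<open>Columns beyond \<open>N\<close> repeat column \<open>N\<close>, so a choice of
      columns may be cut off at \<open>N\<close>.\<close>
    define js' where "js' = (\<lambda>i\<in>{..<m}. min (js i) N)"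
    have js': "L i (js i) = L i (js' i)" if "i < m" for i
      using that N[of i "js i"] by (auto simp: js'_def min_def)
    have "js' \<in> (\<Pi>\<^sub>E i\<in>{..<m}. {..N})" by (auto simp: js'_def)
    then have "minor_poly m L js' k \<in> F"
      unfolding F_def by (rule insertI2[OF UN_I]) (use \<open>k < m\<close> in simp)
    moreover have "\<forall>h\<in>F. eval (\<lambda>ij. g $$ ij) h \<noteq> 0"
      using \<open>g \<in> U\<close> unfolding U_def mem_Collect_eq eval_f by (rule conjunct2)
    ultimately have "eval (\<lambda>ij. g $$ ij) (minor_poly m L js' k) \<noteq> 0" by blast
    then have "det (mat (Suc k) (Suc k) (\<lambda>(r, i). lookup (GL_act m g (L i (js' i))) (unit_pp r))) \<noteq> 0"
      using \<open>k < m\<close> by (subst (asm) eval_minor_poly) (auto intro: distraction_matrixD(1)[OF L])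
    moreover have "mat (Suc k) (Suc k) (\<lambda>(r, i). lookup (GL_act m g (L i (js' i))) (unit_pp r)) =
      mat (Suc k) (Suc k) (\<lambda>(r, i). lookup (GL_act m g (L i (js i))) (unit_pp r))"
      using \<open>k < m\<close> by (intro eq_matI) (auto simp: js')
    ultimately show "det (mat (Suc k) (Suc k) (\<lambda>(r, i). lookup (GL_act m g (L i (js i))) (unit_pp r))) \<noteq> 0"
      by simp
  qed
  ultimately show ?thesis by blast
qed

section \<open>Zero-dimensional monomial ideals\<close>

text \<open>Carries chains of primes to the quotient. As \<open>P\<close> contains \<open>I\<close>,
  membership in \<open>P\<close> can be read off from the coset; this gives primality, and the
  second fact keeps distinct primes distinct.\<close>

lemma (in ideal) primeideal_quotient:
  assumes "cring R" "primeideal P R" "I \<subseteq> P"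
  shows "primeideal ((+>) I ` P) (R Quot I)"
    and "x \<in> carrier R \<Longrightarrow> I +> x \<in> (+>) I ` P \<Longrightarrow> x \<in> P"
proof -
  interpret P: primeideal P R by fact
  have mem: "x \<in> P" if x: "x \<in> carrier R" "I +> x \<in> (+>) I ` P" for x
  proof -
    obtain z where z: "z \<in> P" "I +> x = I +> z" using x(2) by blast
    have "x \<in> I +> z" using a_rcos_self[OF x(1)] z(2) by simp
    then obtain h where "h \<in> I" "x = h \<oplus> z" by (auto simp: a_r_coset_def')
    then show ?thesis using z(1) assms(3) P.a_closed by blast
  qed
  show "x \<in> carrier R \<Longrightarrow> I +> x \<in> (+>) I ` P \<Longrightarrow> x \<in> P" by (rule mem)
  have carr: "carrier (R Quot I) = (+>) I ` carrier R"
    by (auto simp: FactRing_def A_RCOSETS_def' )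
  show "primeideal ((+>) I ` P) (R Quot I)"
  proof (rule primeidealI)
    show "ideal ((+>) I ` P) (R Quot I)"
      by (rule ring_ideal_imp_quot_ideal[OF ideal_axioms P.ideal_axioms])
    show "cring (R Quot I)" by (rule quotient_is_cring[OF assms(1)])
    show "carrier (R Quot I) \<noteq> (+>) I ` P"
    proof
      assume "carrier (R Quot I) = (+>) I ` P"
      then have "I +> x \<in> (+>) I ` P" if "x \<in> carrier R" for x
        using that unfolding carr by (metis imageI)
      then have "carrier R \<subseteq> P" by (intro subsetI mem)
      then show False using P.I_notcarr P.a_subset by (metis subset_antisym)
    qed
    fix a b assume "a \<in> carrier (R Quot I)" "b \<in> carrier (R Quot I)"
      and ab: "a \<otimes>\<^bsub>R Quot I\<^esub> b \<in> (+>) I ` P"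
    then obtain x y where x: "x \<in> carrier R" "a = I +> x" and y: "y \<in> carrier R" "b = I +> y"
      unfolding carr by (elim imageE)
    have "I +> (x \<otimes> y) \<in> (+>) I ` P"
      using ab x y by (simp add: FactRing_def rcoset_mult_add)
    then have "x \<otimes> y \<in> P" by (rule mem[OF m_closed[OF x(1) y(1)]])
    then have "x \<in> P \<or> y \<in> P" by (rule P.I_prime[OF x(1) y(1)])
    then show "a \<in> (+>) I ` P \<or> b \<in> (+>) I ` P" unfolding x(2) y(2) by (elim disjE) simp_all
  qed
qed

lemma primeideal_kernel:
  fixes \<psi> :: "(nat, 'k::field) mpoly \<Rightarrow> 'r::idom"
  assumes "comm_ring_hom \<psi>"
  shows "primeideal {f \<in> carrier (poly_ring n). \<psi> f = 0} (poly_ring n)"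
proof -
  interpret \<psi>: comm_ring_hom \<psi> by fact
  interpret cring "poly_ring n :: (nat, 'k) mpoly ring" by (rule cring_poly_ring)
  show ?thesis
  proof (rule primeidealI)
    show "ideal {f \<in> carrier (poly_ring n). \<psi> f = 0} (poly_ring n)"
    proof (rule ideal_of_subspace)
      show "mpoly.subspace {f \<in> carrier (poly_ring n). \<psi> f = 0}"
        by (rule mpoly.subspaceI)
          (simp_all add: carrier_poly_ring mpoly.subspace_0[OF subspace_supported]
            mpoly.subspace_add[OF subspace_supported] mpoly.subspace_scale[OF subspace_supported]
            \<psi>.hom_add scale_def[symmetric], simp add: scale_def \<psi>.hom_mult)
      fix i and p :: "(nat, 'k) mpoly"
      assume i: "i < n" and p: "p \<in> {f \<in> carrier (poly_ring n). \<psi> f = 0}"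
      have "var i \<in> carrier (poly_ring n :: (nat, 'k) mpoly ring)"
        using i by (simp add: carrier_poly_ring var_def)
      then show "var i * p \<in> {f \<in> carrier (poly_ring n). \<psi> f = 0}"
        using p m_closed[of "var i" p] by (simp add: \<psi>.hom_mult)
    qed auto
    show "carrier (poly_ring n) \<noteq> {f \<in> carrier (poly_ring n). \<psi> f = 0}"
      using one_closed by force
    fix a b :: "(nat, 'k) mpoly"
    assume "a \<in> carrier (poly_ring n)" "b \<in> carrier (poly_ring n)"
      "a \<otimes>\<^bsub>poly_ring n\<^esub> b \<in> {f \<in> carrier (poly_ring n). \<psi> f = 0}"
    then show "a \<in> {f \<in> carrier (poly_ring n). \<psi> f = 0} \<or> b \<in> {f \<in> carrier (poly_ring n). \<psi> f = 0}"
      by (simp add: \<psi>.hom_mult)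
  qed (rule is_cring)
qed

text \<open>
  If no power of \<open>x\<^sub>i\<close> lies in the monomial ideal, it is contained in the prime ideal of the variables
  other than \<open>x\<^sub>i\<close>, which is not maximal.
\<close>
lemma krull_dim_0_pure_power:
  fixes T :: "nat pp set"
  assumes T: "T \<subseteq> pps n" and ideal: "ideal (supported T :: (nat, 'k::field) mpoly set) (poly_ring n)"
    and dim: "has_krull_dim (poly_ring n Quot (supported T :: (nat, 'k) mpoly set)) 0"
    and "i < n"
  shows "\<exists>e. Poly_Mapping.single i e \<in> T"
proof (rule ccontr)
  assume no: "\<nexists>e. Poly_Mapping.single i e \<in> T"
  let ?R = "poly_ring n :: (nat, 'k) mpoly ring"
  let ?I = "supported T :: (nat, 'k) mpoly set"
  \<comment> \<open>\<open>?\<psi>\<close> sends \<open>var i\<close> to the indeterminate and the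
    other variables to 0, \<open>?\<epsilon>\<close> evaluates at the origin. Their kernels
    \<open>P0\<close> and \<open>P1\<close> form the chain; \<open>var i\<close> lies only in the
    second.\<close>
  let ?\<phi> = "\<lambda>j. if j = i then [:0, 1:] else (0 :: 'k poly)"
  let ?\<psi> = "poly_hom (\<lambda>c :: 'k. [:c:]) ?\<phi>"
  let ?\<epsilon> = "eval (\<lambda>_. 0) :: (nat, 'k) mpoly \<Rightarrow> 'k"
  interpret ideal ?I ?R by fact
  interpret \<psi>: comm_ring_hom ?\<psi> by (rule comm_ring_hom_poly_hom[OF comm_ring_hom_pCons])
  define P0 where "P0 = {f \<in> carrier ?R. ?\<psi> f = 0}"
  define P1 where "P1 = {f \<in> carrier ?R. ?\<epsilon> f = 0}"
  have prime: "primeideal P0 ?R" "primeideal P1 ?R"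
    unfolding P0_def P1_def
    by (intro primeideal_kernel comm_ring_hom_poly_hom comm_ring_hom_pCons comm_ring_hom_id)+
  have eps: "?\<epsilon> f = poly (?\<psi> f) 0" for f
    unfolding poly_poly_hom by (rule arg_cong[where f = "\<lambda>a. eval a f"]) auto
  have "?I \<subseteq> P0"
  proof
    fix f assume f: "f \<in> ?I"
    \<comment> \<open>A power product of \<open>T\<close> is not a power of \<open>var i\<close>,
      hence contains a variable sent to 0. The exponent 0 in \<open>no\<close> covers the power
      product 1.\<close>
    have prod0: "(\<Prod>j\<in>keys t. ?\<phi> j ^ lookup t j) = 0" if "t \<in> keys f" for t
    proof -
      have "t \<in> T" using f that by (auto simp: supported_def)
      then have "t \<noteq> Poly_Mapping.single i (lookup t i)" using no by metis
      then obtain j where "lookup t j \<noteq> lookup (Poly_Mapping.single i (lookup t i)) j"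
        by (metis poly_mapping_eqI)
      then have "j \<noteq> i" "j \<in> keys t" by (cases "j = i"; simp add: lookup_single when_def in_keys_iff)+
      then show ?thesis by (intro prod_zero) (auto simp: in_keys_iff)
    qed
    have "?\<psi> f = 0"
      unfolding poly_hom_def by (intro sum.neutral ballI) (simp only: prod0 mult_zero_right)
    then show "f \<in> P0" using f a_subset by (auto simp: P0_def)
  qed
  moreover have "P0 \<subseteq> P1" using eps by (auto simp: P0_def P1_def)
  ultimately have sub: "?I \<subseteq> P0" "?I \<subseteq> P1" by auto
  have "var i \<in> carrier ?R" using \<open>i < n\<close> by (simp add: carrier_poly_ring var_def)
  moreover have "?\<psi> (var i) = [:0, 1:]" by (simp add: poly_hom_var[OF comm_ring_hom_pCons])
  ultimately have x: "var i \<in> carrier ?R" "var i \<in> P1" "var i \<notin> P0"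
    by (auto simp: P0_def P1_def eps)
  let ?q = "\<lambda>P. (+>\<^bsub>?R\<^esub>) ?I ` P"
  note q0 = primeideal_quotient[OF cring_poly_ring prime(1) sub(1)]
  note q1 = primeideal_quotient[OF cring_poly_ring prime(2) sub(2)]
  have "?q P0 \<subset> ?q P1"
  proof (rule psubsetI)
    show "?q P0 \<subseteq> ?q P1" using \<open>P0 \<subseteq> P1\<close> by (rule image_mono)
    show "?q P0 \<noteq> ?q P1" using q0(2)[OF x(1)] x(2,3) by blast
  qed
  then have "prime_chain (?R Quot ?I) 1 (\<lambda>d. if d = 0 then ?q P0 else ?q P1)"
    using q0(1) q1(1) unfolding prime_chain_def by auto
  then show False using dim unfolding has_krull_dim_def by fastforce
qed

section \<open>Irreducible components\<close>

lemma irr_monomial_ideal_eq: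
  assumes "keys a \<subseteq> {..<m}"
  shows "irr_monomial_ideal m a = supported {u \<in> pps m. \<exists>i\<in>keys a. lookup a i \<le> lookup u i}"
proof -
  let ?S = "(\<lambda>i. Poly_Mapping.single i (lookup a i)) ` keys a"
  have "{s + u | s u. s \<in> ?S \<and> u \<in> pps m} = {u \<in> pps m. \<exists>i\<in>keys a. lookup a i \<le> lookup u i}" (is "?A = ?B")
  proof
    show "?A \<subseteq> ?B"
    proof
      fix w assume "w \<in> ?A"
      then obtain i u where w: "w = Poly_Mapping.single i (lookup a i) + u" "i \<in> keys a" "u \<in> pps m" by auto
      have "lookup a i \<le> lookup w i" by (simp add: w(1) lookup_add)
      moreover have "w \<in> pps m"
        using assms w(2,3) by (auto simp: w(1) keys_add_nat split: if_splits)
      ultimately show "w \<in> ?B" using w(2) by blast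
    qed
    show "?B \<subseteq> ?A"
    proof
      fix w assume "w \<in> ?B"
      then obtain i where i: "i \<in> keys a" "lookup a i \<le> lookup w i" and w: "w \<in> pps m" by auto
      let ?s = "Poly_Mapping.single i (lookup a i)"
      have "w = ?s + (w - ?s)" by (rule pp_diff_add) (use i in \<open>auto simp: lookup_single when_def\<close>)
      moreover have "keys (w - ?s) \<subseteq> keys w" by (auto simp: in_keys_iff lookup_minus)
      ultimately show "w \<in> ?A" using i(1) w by blast
    qed
  qed
  moreover have "?S \<subseteq> pps m" using assms by (auto split: if_splits)
  ultimately have "Idl\<^bsub>poly_ring m\<^esub> (mon ` ?S) =
      supported {u \<in> pps m. \<exists>i\<in>keys a. lookup a i \<le> lookup u i}"
    using Idl_mon[of ?S m] by simp
  then show ?thesis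
    unfolding irr_monomial_ideal_def var_power by (simp only: image_image)
qed

text \<open>Setting the extra variable of the larger ring, of index \<open>n\<close>, to 1.\<close>

definition drop_var :: "nat \<Rightarrow> nat pp \<Rightarrow> nat pp" where
  "drop_var n t = t - Poly_Mapping.single n (lookup t n)"

lemma lookup_drop_var: "lookup (drop_var n t) i = (if i = n then 0 else lookup t i)"
  by (simp add: drop_var_def lookup_minus lookup_single when_def)

lemma drop_var_split: "t = drop_var n t + Poly_Mapping.single n (lookup t n)"
  by (rule poly_mapping_eqI) (simp add: lookup_add lookup_drop_var lookup_single when_def)

lemma pps_iff: "keys (t :: nat pp) \<subseteq> {..<m} \<longleftrightarrow> (\<forall>i\<ge>m. lookup t i = 0)"
  unfolding subset_iff in_keys_iff lessThan_iff by (metis leD leI)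

lemma drop_var_pps: "t \<in> pps (Suc n) \<Longrightarrow> drop_var n t \<in> pps n"
  by (simp add: pps_iff lookup_drop_var)

lemma drop_var_id: "t \<in> pps n \<Longrightarrow> drop_var n t = t"
  by (rule poly_mapping_eqI) (simp add: pps_iff lookup_drop_var)

text \<open>
  \<open>T0\<close> stands for the power products of a zero-dimensional monomial ideal in \<open>n\<close> variables and \<open>T\<close> for
  those of its extension to \<open>n + 1\<close> variables.
\<close>
locale zero_dim_pps =
  fixes n :: nat and T0 T :: "nat pp set"
  assumes T0_pps: "T0 \<subseteq> pps n"
    and T0_add: "s \<in> T0 \<Longrightarrow> u \<in> pps n \<Longrightarrow> s + u \<in> T0"
    and T_eq: "T = {u \<in> pps (Suc n). drop_var n u \<in> T0}"
    and finite_standard: "finite (pps n - T0)"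
begin

lemma T0_le:
  assumes "s \<in> T0" "u \<in> pps n" "\<And>i. i < n \<Longrightarrow> lookup s i \<le> lookup u i"
  shows "u \<in> T0"
proof -
  have "s \<in> pps n" using assms(1) T0_pps by (rule rev_subsetD)
  then have "lookup s i \<le> lookup u i" for i
    using assms(3)[of i] by (cases "i < n") (simp_all add: pps_iff)
  then have "u = s + (u - s)" by (rule pp_diff_add)
  moreover have "u - s \<in> pps n" using assms(2) by (simp add: pps_iff lookup_minus)
  ultimately show ?thesis using T0_add[OF assms(1)] by metis
qed

text \<open>Otherwise \<open>drop_var n u\<close> would divide \<open>t\<close> and force it into
  \<open>T0\<close>. Both the decomposition and the vanishing at the points rest on this.\<close>

lemma T_exponent_gt:
  assumes "u \<in> T" "t \<in> pps n - T0"
  shows "\<exists>i<n. lookup t i < lookup u i"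
proof (rule ccontr)
  assume "\<not> (\<exists>i<n. lookup t i < lookup u i)"
  then have "lookup (drop_var n u) i \<le> lookup t i" if "i < n" for i
    using that by (simp add: lookup_drop_var) (metis leI)
  then have "t \<in> T0" using assms by (intro T0_le[of "drop_var n u" t]) (simp_all add: T_eq)
  then show False using assms(2) by simp
qed

lemma T_pps: "T \<subseteq> pps (Suc n)"
  unfolding T_eq by blast

lemma T0_subset_T: "T0 \<subseteq> T"
proof
  fix t assume t: "t \<in> T0"
  then have "t \<in> pps n" using T0_pps by (rule rev_subsetD)
  then show "t \<in> T" using t by (simp add: T_eq drop_var_id pps_iff)
qed

lemma T_add:
  assumes "t \<in> T" "u \<in> pps (Suc n)"
  shows "t + u \<in> T"
proof -
  have t: "t \<in> pps (Suc n)" "drop_var n t \<in> T0" using assms(1) by (simp_all add: T_eq)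
  have tu: "t + u \<in> pps (Suc n)" using t(1) assms(2) by (simp add: keys_add_nat)
  moreover have "drop_var n (t + u) \<in> T0"
    by (rule T0_le[OF t(2)]) (use drop_var_pps[OF tu] in \<open>simp_all add: lookup_drop_var lookup_add\<close>)
  ultimately show ?thesis by (simp add: T_eq)
qed

text \<open>The set \<open>A\<close> is left open: \<open>T0\<close> generates the extended ideal,
  and all of \<open>T\<close> occurs as the set of leading power products.\<close>

lemma Idl_mon_T:
  assumes "T0 \<subseteq> A" "A \<subseteq> T"
  shows "Idl\<^bsub>poly_ring (Suc n)\<^esub> (mon ` A) = (supported T :: (nat, 'k::field) mpoly set)"
proof -
  have "{s + u | s u. s \<in> A \<and> u \<in> pps (Suc n)} = T"
  proof
    show "{s + u | s u. s \<in> A \<and> u \<in> pps (Suc n)} \<subseteq> T"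
      using T_add assms(2) by blast
    show "T \<subseteq> {s + u | s u. s \<in> A \<and> u \<in> pps (Suc n)}"
    proof
      fix t assume t: "t \<in> T"
      have "t = drop_var n t + Poly_Mapping.single n (lookup t n)" by (rule drop_var_split)
      moreover have "Poly_Mapping.single n (lookup t n) \<in> pps (Suc n)" by simp
      moreover have "drop_var n t \<in> A" using t assms(1) unfolding T_eq by blast
      ultimately show "t \<in> {s + u | s u. s \<in> A \<and> u \<in> pps (Suc n)}" by blast
    qed
  qed
  moreover have "A \<subseteq> pps (Suc n)" using assms(2) T_pps by (rule subset_trans)
  ultimately show ?thesis by (simp only: Idl_mon)
qed

text \<open>The monomial basis of the socle of P/I; its elements correspond to the irreducible
  components.\<close>

definition maximal_standard :: "nat pp set" where
  "maximal_standard = {t \<in> pps n - T0. \<forall>s\<in>pps n - T0. (\<forall>i<n. lookup t i \<le> lookup s i) \<longrightarrow> s = t}"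

text \<open>All \<open>n\<close> exponents are raised by one: the irreducible ideal with exponents
  \<open>corner t\<close> misses precisely the divisors of \<open>t\<close>, up to powers of the
  extra variable.\<close>

definition corner :: "nat pp \<Rightarrow> nat pp" where
  "corner t = t + (\<Sum>i<n. unit_pp i)"

lemma lookup_corner:
  assumes "t \<in> pps n"
  shows "lookup (corner t) i = (if i < n then lookup t i + 1 else 0)"
  using assms by (simp add: corner_def pps_iff lookup_add lookup_sum lookup_single when_def not_less)

lemma keys_corner: "t \<in> pps n \<Longrightarrow> keys (corner t) = {..<n}"
  by (auto simp: in_keys_iff lookup_corner split: if_splits)

text \<open>Only finitely many standard power products are multiples of \<open>t\<close>; one of
  largest degree is maximal, since a proper multiple has larger degree.\<close>

lemma below_maximal_standard:
  assumes "t \<in> pps n - T0"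
  shows "\<exists>s\<in>maximal_standard. \<forall>i<n. lookup t i \<le> lookup s i"
proof -
  define A where "A = {s \<in> pps n - T0. \<forall>i<n. lookup t i \<le> lookup s i}"
  have "finite A" by (rule finite_subset[OF _ finite_standard]) (auto simp: A_def)
  moreover have "t \<in> A" using assms by (simp add: A_def)
  ultimately have "Max (pp_deg ` A) \<in> pp_deg ` A" by (intro Max_in) auto
  then obtain s where s: "s \<in> A" "Max (pp_deg ` A) = pp_deg s" by blast
  have s_max: "pp_deg u \<le> pp_deg s" if "u \<in> A" for u
    using that \<open>finite A\<close> unfolding s(2)[symmetric] by simp
  have "u = s" if u: "u \<in> pps n - T0" "\<forall>i<n. lookup s i \<le> lookup u i" for u
  proof -
    have "u \<in> A" using s(1) u by (auto simp: A_def intro: order_trans)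
    then have "pp_deg u \<le> pp_deg s" by (rule s_max)
    moreover have s_pps: "s \<in> pps n" "u \<in> pps n" using s(1) u(1) by (simp_all add: A_def)
    have le: "lookup s i \<le> lookup u i" for i
      using s_pps u(2) by (cases "i < n") (simp_all add: pps_iff)
    then have us: "u = s + (u - s)" by (rule pp_diff_add)
    then have "pp_deg u = pp_deg s + pp_deg (u - s)" by (metis pp_deg_add)
    ultimately have "u - s = 0" by (intro pp_eq_zero) simp
    then show "u = s" using us by simp
  qed
  then have "s \<in> maximal_standard" using s(1) by (simp add: maximal_standard_def A_def)
  then show ?thesis using s(1) by (auto simp: A_def)
qed

lemma irr_monomial_ideal_corner:
  assumes "t \<in> pps n"
  shows "irr_monomial_ideal (Suc n) (corner t) =
    (supported {u \<in> pps (Suc n). \<exists>i<n. lookup t i < lookup u i} :: (nat, 'k::field) mpoly set)"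
proof -
  have "keys (corner t) \<subseteq> {..<Suc n}" using keys_corner[OF assms] by auto
  then show ?thesis
    unfolding irr_monomial_ideal_eq[OF \<open>keys (corner t) \<subseteq> {..<Suc n}\<close>] keys_corner[OF assms]
    using assms
    by (intro arg_cong[where f = supported] Collect_cong conj_cong refl)
      (auto simp: lookup_corner plus_1_eq_Suc Suc_le_eq Bex_def)
qed

text \<open>A power product outside \<open>T\<close> divides a maximal standard one, up to the extra
  variable, and is missed by its component. No component can be omitted: for maximal
  \<open>t\<close>, \<open>mon t\<close> lies in all the others but not in the ideal.\<close>

lemma irredundant_decomposition_corners:
  "irredundant_decomposition (Suc n) (supported T :: (nat, 'k::field) mpoly set)
    ((\<lambda>t. irr_monomial_ideal (Suc n) (corner t)) ` maximal_standard)"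
proof -
  let ?Q = "\<lambda>t. irr_monomial_ideal (Suc n) (corner t) :: (nat, 'k) mpoly set"
  have max: "t \<in> pps n" "t \<in> pps n - T0" if "t \<in> maximal_standard" for t
    using that by (simp_all add: maximal_standard_def)
  have "finite maximal_standard"
    by (rule finite_subset[OF _ finite_standard]) (auto simp: maximal_standard_def)
  moreover have "\<forall>Q\<in>?Q ` maximal_standard. \<exists>a. keys a \<subseteq> {..<Suc n} \<and> Q = irr_monomial_ideal (Suc n) a"
  proof
    fix Q assume "Q \<in> ?Q ` maximal_standard"
    then obtain t where "t \<in> maximal_standard" "Q = ?Q t" by blast
    then show "\<exists>a. keys a \<subseteq> {..<Suc n} \<and> Q = irr_monomial_ideal (Suc n) a"
      using keys_corner[OF max(1)] by (intro exI[of _ "corner t"]) auto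
  qed
  moreover have "carrier (poly_ring (Suc n)) \<inter> \<Inter> (?Q ` maximal_standard) = supported T"
  proof
    have "supported T \<subseteq> carrier (poly_ring (Suc n))"
      unfolding carrier_poly_ring by (rule supported_mono[OF T_pps])
    moreover have "supported T \<subseteq> ?Q t" if "t \<in> maximal_standard" for t
      unfolding irr_monomial_ideal_corner[OF max(1)[OF that]]
      using T_exponent_gt[OF _ max(2)[OF that]] T_pps by (intro supported_mono) auto
    ultimately show "supported T \<subseteq> carrier (poly_ring (Suc n)) \<inter> \<Inter> (?Q ` maximal_standard)"
      by blast
    show "carrier (poly_ring (Suc n)) \<inter> \<Inter> (?Q ` maximal_standard) \<subseteq> supported T"
    proof
      fix f assume f: "f \<in> carrier (poly_ring (Suc n)) \<inter> \<Inter> (?Q ` maximal_standard)"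
      have "u \<in> T" if "u \<in> keys f" for u
      proof (rule ccontr)
        assume "u \<notin> T"
        have u: "u \<in> pps (Suc n)" using f that by (auto simp: carrier_poly_ring supported_def)
        then have "drop_var n u \<in> pps n - T0" using \<open>u \<notin> T\<close> drop_var_pps[OF u] by (simp add: T_eq)
        from below_maximal_standard[OF this] obtain t where
          t: "t \<in> maximal_standard" "\<forall>i<n. lookup (drop_var n u) i \<le> lookup t i" by blast
        have "f \<in> ?Q t" using f t(1) by blast
        then have "u \<in> {u \<in> pps (Suc n). \<exists>i<n. lookup t i < lookup u i}"
          using that unfolding irr_monomial_ideal_corner[OF max(1)[OF t(1)]] supported_def by blast
        then obtain i where "i < n" "lookup t i < lookup u i" by blast
        then show False using t(2) by (auto simp: lookup_drop_var)
      qed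
      then show "f \<in> supported T" by (auto simp: supported_def)
    qed
  qed
  moreover have "carrier (poly_ring (Suc n)) \<inter> \<Inter> D \<noteq> supported T" if D: "D \<subset> ?Q ` maximal_standard" for D
  proof -
    obtain t where t: "t \<in> maximal_standard" "?Q t \<notin> D" using D by blast
    have "mon t \<in> Q" if "Q \<in> D" for Q
    proof -
      have "Q \<in> ?Q ` maximal_standard" using psubset_imp_subset[OF D] that by (rule subsetD)
      then obtain s where s: "s \<in> maximal_standard" "Q = ?Q s" by (elim imageE)
      then have "s \<noteq> t" using t(2) that by blast
      moreover have "s \<in> pps n - T0" by (rule max(2)[OF s(1)])
      ultimately have "\<not> (\<forall>i<n. lookup t i \<le> lookup s i)"
        using t(1) unfolding maximal_standard_def by blast
      then obtain i where "i < n" "lookup s i < lookup t i" by (auto simp: not_le)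
      moreover have "t \<in> pps (Suc n)" using max(1)[OF t(1)] by (simp add: pps_iff)
      ultimately show ?thesis
        unfolding s(2) irr_monomial_ideal_corner[OF max(1)[OF s(1)]] by auto
    qed
    moreover have "mon t \<in> carrier (poly_ring (Suc n) :: (nat, 'k) mpoly ring)"
      using max(1)[OF t(1)] by (simp add: carrier_poly_ring pps_iff)
    moreover have "mon t \<notin> (supported T :: (nat, 'k) mpoly set)"
      using max(2)[OF t(1)] by (simp add: T_eq drop_var_id)
    ultimately show ?thesis by blast
  qed
  ultimately show ?thesis unfolding irredundant_decomposition_def by blast
qed

text \<open>Makes the hypothesis on components available at a standard \<open>t\<close>. The strict
  inequality says that column \<open>lookup t i\<close>, counted from 0, is among the columns
  compared in \<open>radical_for_irr\<close>.\<close>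

lemma radical_corner:
  assumes "radical_for (Suc n) L (supported T)" "t \<in> pps n - T0"
  shows "\<exists>a. keys a = {..<n} \<and> (\<forall>i<n. lookup t i < lookup a i) \<and> radical_for_irr L a"
proof -
  obtain s where s: "s \<in> maximal_standard" "\<forall>i<n. lookup t i \<le> lookup s i"
    using below_maximal_standard[OF assms(2)] by blast
  have s_pps: "s \<in> pps n" using s(1) by (simp add: maximal_standard_def)
  have "irreducible_component (Suc n) (supported T) (irr_monomial_ideal (Suc n) (corner s) :: (nat, 'a) mpoly set)"
    unfolding irreducible_component_def
    using irredundant_decomposition_corners s(1) by blast
  moreover have "keys (corner s) \<subseteq> {..<Suc n}" using keys_corner[OF s_pps] by auto
  ultimately have "radical_for_irr L (corner s)"
    using assms(1) unfolding radical_for_def by blast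
  then show ?thesis
    using s(2) s_pps by (intro exI[of _ "corner s"]) (auto simp: keys_corner lookup_corner le_imp_less_Suc)
qed

end

section \<open>The points of a distraction\<close>

lemma eval_linear_form:
  assumes "p \<in> linear_forms m"
  shows "eval a p = (\<Sum>c<m. lookup p (unit_pp c) * a c)"
proof -
  interpret comm_ring_hom "eval a :: (nat, 'a) mpoly \<Rightarrow> 'a"
    by (rule comm_ring_hom_poly_hom[OF comm_ring_hom_id])
  show ?thesis
    by (subst linear_form_expand[OF assms])
      (simp add: hom_sum poly_hom_scale[OF comm_ring_hom_id] poly_hom_var[OF comm_ring_hom_id])
qed

lemma eval_dist_pp: "eval a (dist_pp m L t) = (\<Prod>i<m. \<Prod>j<lookup t i. eval a (L i j))"
proof -
  interpret comm_ring_hom "eval a :: (nat, 'a) mpoly \<Rightarrow> 'a"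
    by (rule comm_ring_hom_poly_hom[OF comm_ring_hom_id])
  show ?thesis by (simp add: dist_pp_def hom_prod)
qed

lemma eval_dist_pp_eq_0:
  assumes "i < m" "j < lookup t i" "eval a (L i j) = 0"
  shows "eval a (dist_pp m L t) = 0"
proof -
  have "(\<Prod>j<lookup t i. eval a (L i j)) = 0" using assms(2,3) by (intro prod_zero) auto
  then show ?thesis unfolding eval_dist_pp using assms(1) by (intro prod_zero) auto
qed

lemma subspace_vanishing: "mpoly.subspace {p :: ('v, 'k::field) mpoly. eval a p = 0}"
proof -
  interpret comm_ring_hom "eval a :: ('v, 'k) mpoly \<Rightarrow> 'k"
    by (rule comm_ring_hom_poly_hom[OF comm_ring_hom_id])
  show ?thesis
    by (rule mpoly.subspaceI) (simp_all add: hom_add poly_hom_scale[OF comm_ring_hom_id])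
qed

lemma eval_span_eq_0:
  assumes "\<And>p. p \<in> B \<Longrightarrow> eval a p = 0" "p \<in> mpoly.span B"
  shows "eval a p = 0"
proof -
  have "mpoly.span B \<subseteq> {p. eval a p = 0}"
    by (rule mpoly.span_minimal[OF _ subspace_vanishing]) (use assms(1) in blast)
  then show ?thesis using assms(2) by blast
qed

text \<open>The last row of the inverse of \<open>coeff_mat\<close> is dual to the chosen entries:
  paired with their coefficients it gives 0, except for the last entry, where it gives 1.\<close>

lemma distraction_point:
  assumes L: "distraction_matrix (Suc n) L"
  shows "\<exists>v\<in>carrier_vec (Suc n). (\<forall>i<n. eval (\<lambda>i. v $ i) (L i (js i)) = 0) \<and>
    eval (\<lambda>i. v $ i) (L n (js n)) = 1"
proof -
  obtain B where B: "B \<in> carrier_mat (Suc n) (Suc n)" "B * coeff_mat (Suc n) L js = 1\<^sub>m (Suc n)"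
    using coeff_mat_inverse[OF L] .
  define v where "v = vec (Suc n) (\<lambda>c. B $$ (n, c))"
  have "eval (\<lambda>i. v $ i) (L i (js i)) = (if i = n then 1 else 0)" if "i < Suc n" for i
  proof -
    have "eval (\<lambda>i. v $ i) (L i (js i)) = (\<Sum>c<Suc n. B $$ (n, c) * lookup (L i (js i)) (unit_pp c))"
      unfolding eval_linear_form[OF distraction_matrixD(1)[OF L that]]
      by (rule sum.cong) (simp_all add: v_def)
    also have "\<dots> = (B * coeff_mat (Suc n) L js) $$ (n, i)"
      using that B(1) by (simp add: coeff_mat_def scalar_prod_def atLeast0LessThan)
    finally show ?thesis using that unfolding B(2) by simp
  qed
  then show ?thesis by (intro bexI[of _ v]) (simp_all add: v_def)
qed

text \<open>Expand a form in the chosen entries: evaluation at \<open>a\<close> isolates the last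
  coefficient. The span thus depends on the point alone, which links the condition on spans in
  \<open>radical_for_irr\<close> to points.\<close>

lemma span_eq_vanishing_forms:
  assumes L: "distraction_matrix (Suc n) L"
    and zero: "\<And>i. i < n \<Longrightarrow> eval a (L i (js i)) = 0" and nz: "eval a (L n (js n)) \<noteq> 0"
  shows "mpoly.span ((\<lambda>i. L i (js i)) ` {..<n}) = {p \<in> linear_forms (Suc n). eval a p = 0}"
proof
  have "L i (js i) \<in> linear_forms (Suc n)" if "i < n" for i
    using that by (intro distraction_matrixD(1)[OF L]) simp
  then have "mpoly.span ((\<lambda>i. L i (js i)) ` {..<n}) \<subseteq> linear_forms (Suc n)"
    unfolding linear_forms_supported by (intro mpoly.span_minimal subspace_supported) blast
  moreover have "eval a p = 0" if "p \<in> mpoly.span ((\<lambda>i. L i (js i)) ` {..<n})" for p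
    by (rule eval_span_eq_0[OF _ that]) (use zero in auto)
  ultimately show "mpoly.span ((\<lambda>i. L i (js i)) ` {..<n}) \<subseteq> {p \<in> linear_forms (Suc n). eval a p = 0}"
    by blast
  show "{p \<in> linear_forms (Suc n). eval a p = 0} \<subseteq> mpoly.span ((\<lambda>i. L i (js i)) ` {..<n})"
  proof
    fix p assume p: "p \<in> {p \<in> linear_forms (Suc n). eval a p = 0}"
    interpret comm_ring_hom "eval a :: (nat, 'a) mpoly \<Rightarrow> 'a"
      by (rule comm_ring_hom_poly_hom[OF comm_ring_hom_id])
    have "p \<in> mpoly.span ((\<lambda>i. L i (js i)) ` {..<Suc n})"
      using p distraction_matrixD(2)[OF L, of js] by simp
    then obtain c where c: "p = (\<Sum>i<Suc n. scale (c i) (L i (js i)))"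
      unfolding span_image_sum[OF finite_lessThan] by blast
    have "eval a p = (\<Sum>i<Suc n. c i * eval a (L i (js i)))"
      unfolding c hom_sum by (simp add: poly_hom_scale[OF comm_ring_hom_id])
    also have "\<dots> = c n * eval a (L n (js n))" by (simp add: zero)
    finally have "c n = 0" using p nz by simp
    then have "p = (\<Sum>i<n. scale (c i) (L i (js i)))" by (simp add: c)
    then show "p \<in> mpoly.span ((\<lambda>i. L i (js i)) ` {..<n})"
      unfolding span_image_sum[OF finite_lessThan] by blast
  qed
qed

text \<open>Otherwise \<open>L n j\<close> and the chosen entries of the first \<open>n\<close> rows
  would all vanish at \<open>a\<close>, although they span all linear forms, including
  \<open>L n (js n)\<close>.\<close>

lemma distraction_point_last_nonzero:
  assumes L: "distraction_matrix (Suc n) L"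
    and zero: "\<And>i. i < n \<Longrightarrow> eval a (L i (js i)) = 0" and nz: "eval a (L n (js n)) \<noteq> 0"
  shows "eval a (L n j) \<noteq> 0"
proof
  assume "eval a (L n j) = 0"
  then have "eval a p = 0" if "p \<in> (\<lambda>i. L i ((js(n := j)) i)) ` {..<Suc n}" for p
    using that zero by (auto simp: less_Suc_eq)
  moreover have "L n (js n) \<in> mpoly.span ((\<lambda>i. L i ((js(n := j)) i)) ` {..<Suc n})"
    unfolding distraction_matrixD(2)[OF L] by (intro distraction_matrixD(1)[OF L]) simp
  ultimately have "eval a (L n (js n)) = 0" by (rule eval_span_eq_0)
  then show False using nz by simp
qed

text \<open>If the entry vanished, the choices \<open>js\<close> and \<open>js(i := j)\<close> would
  both span the forms vanishing at \<open>a\<close>, although radicality makes their spans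
  distinct.\<close>

lemma distraction_point_other_nonzero:
  assumes L: "distraction_matrix (Suc n) L"
    and zero: "\<And>i. i < n \<Longrightarrow> eval a (L i (js i)) = 0" and nz: "eval a (L n (js n)) \<noteq> 0"
    and rad: "radical_for_irr L e" "keys e = {..<n}" "\<And>i. i < n \<Longrightarrow> js i < lookup e i"
    and ij: "i < n" "j < js i"
  shows "eval a (L i j) \<noteq> 0"
proof
  assume z: "eval a (L i j) = 0"
  define js' where "js' = js(i := j)"
  have zero': "eval a (L r (js' r)) = 0" if "r < n" for r
    using zero[OF that] z by (simp add: js'_def)
  have "eval a (L n (js' n)) \<noteq> 0" using nz ij(1) by (simp add: js'_def)
  from span_eq_vanishing_forms[of n L a js', OF L zero' this]
    span_eq_vanishing_forms[of n L a js, OF L zero nz]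
  have spans: "mpoly.span ((\<lambda>i. L i (js' i)) ` {..<n}) = mpoly.span ((\<lambda>i. L i (js i)) ` {..<n})" by simp
  have restr: "(\<lambda>r. L r (restrict s {..<n} r)) ` {..<n} = (\<lambda>r. L r (s r)) ` {..<n}" for s :: "nat \<Rightarrow> nat"
    by (rule image_cong) simp_all
  have js'_less: "js' r < lookup e r" if "r < n" for r
    using rad(3)[OF that] ij(2) by (auto simp: js'_def)
  have "restrict js' {..<n} = restrict js {..<n}"
  proof (rule inj_onD[OF rad(1)[unfolded radical_for_irr_def rad(2)]])
    show "mpoly.span ((\<lambda>r. L r (restrict js' {..<n} r)) ` {..<n}) =
      mpoly.span ((\<lambda>r. L r (restrict js {..<n} r)) ` {..<n})"
      unfolding restr by (rule spans)
    show "restrict js' {..<n} \<in> (\<Pi>\<^sub>E i\<in>{..<n}. {..<lookup e i})" using js'_less by simp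
    show "restrict js {..<n} \<in> (\<Pi>\<^sub>E i\<in>{..<n}. {..<lookup e i})" using rad(3) by simp
  qed
  then have "restrict js' {..<n} i = restrict js {..<n} i" by (rule fun_cong)
  then show False using ij by (simp add: js'_def)
qed

lemma eval_smult_linear_form:
  assumes "p \<in> linear_forms m" "v \<in> carrier_vec m"
  shows "eval (\<lambda>i. (c \<cdot>\<^sub>v v) $ i) p = c * eval (\<lambda>i. v $ i) p"
  unfolding eval_linear_form[OF assms(1)] sum_distrib_left
  by (rule sum.cong) (use assms(2) in \<open>simp_all add: mult.left_commute\<close>)

context zero_dim_pps
begin

text \<open>
  For the converse inclusion write a form vanishing at the points as the distraction of some \<open>q\<close>. If a
  power product \<open>t\<close> occurring in \<open>q\<close> is outside \<open>T\<close> and has least degree in the first \<open>n\<close> variables,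
  then at the point attached to \<open>t\<close> the distractions of all other power products of \<open>q\<close> vanish.
\<close>
lemma distraction_ideal_of_points:
  assumes L: "distraction_matrix (Suc n) (L :: nat \<Rightarrow> nat \<Rightarrow> (nat, 'k::field) mpoly)"
    and rad: "radical_for (Suc n) L (supported T)"
  shows "\<exists>X \<subseteq> proj_points (Suc n). finite X \<and>
    mpoly.span (dist_pp (Suc n) L ` T) = ideal_of_points (Suc n) X"
proof -
  let ?m = "Suc n"
  let ?R = "poly_ring ?m :: (nat, 'k) mpoly ring"
  let ?J = "mpoly.span (dist_pp ?m L ` T)"
  obtain P where P: "\<And>js. P js \<in> carrier_vec ?m"
    "\<And>js i. i < n \<Longrightarrow> eval (\<lambda>i. P js $ i) (L i (js i)) = 0"
    "\<And>js. eval (\<lambda>i. P js $ i) (L n (js n)) = 1"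
    using distraction_point[OF L] by metis
  have lin: "L i j \<in> linear_forms ?m" if "i < ?m" for i j
    using that by (rule distraction_matrixD(1)[OF L])
  \<comment> \<open>The point attached to \<open>t\<close>: with columns counted from 0,
    \<open>lookup t i\<close> is the first column of row \<open>i\<close> that D(t) does not
    use.\<close>
  define pt where "pt t = P (lookup t)" for t
  define X where "X = (\<lambda>t. proj_rel ?m `` {pt t}) ` (pps n - T0)"
  have pt_nz: "pt t \<noteq> 0\<^sub>v ?m" for t
  proof
    assume "pt t = 0\<^sub>v ?m"
    then have "eval (\<lambda>i. pt t $ i) (L n (lookup t n)) = 0"
      by (simp add: eval_linear_form[OF lin])
    then show False using P(3)[of "lookup t"] by (simp add: pt_def)
  qed
  have pt_carrier: "pt t \<in> carrier_vec ?m - {0\<^sub>v ?m}" for t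
    using P(1)[of "lookup t"] pt_nz by (simp add: pt_def)
  have "X \<subseteq> proj_points ?m"
    unfolding X_def proj_points_def by (intro image_subsetI quotientI pt_carrier)
  moreover have "finite X" unfolding X_def by (rule finite_imageI[OF finite_standard])
  moreover have "?J = ideal_of_points ?m X"
  proof
    interpret cring ?R by (rule cring_poly_ring)
    let ?G = "{p \<in> carrier ?R. homogeneous p \<and> (\<forall>x\<in>X. \<forall>v\<in>x. eval (\<lambda>i. v $ i) p = 0)}"
    have G_sub: "?G \<subseteq> carrier ?R" by blast
    have "dist_pp ?m L u \<in> ?G" if u: "u \<in> T" for u
    proof (intro CollectI conjI ballI)
      have "u \<in> pps ?m" using u T_pps by (rule rev_subsetD)
      then have D: "dist_pp ?m L u \<in> supported (pps_of_deg ?m (pp_deg u))"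
        by (intro dist_pp_supported lin)
      then show "dist_pp ?m L u \<in> carrier ?R" by (auto simp: carrier_poly_ring supported_def)
      show "homogeneous (dist_pp ?m L u)"
        using D unfolding homogeneous_def supported_def by blast
      fix x v assume "x \<in> X" "v \<in> x"
      then obtain t c where t: "t \<in> pps n - T0" and v: "v = c \<cdot>\<^sub>v pt t"
        by (auto simp: X_def proj_rel_def)
      \<comment> \<open>Hence an entry of row \<open>i\<close> that vanishes at the point is a
        factor of D(u).\<close>
      obtain i where i: "i < n" "lookup t i < lookup u i" using T_exponent_gt[OF u t] by blast
      show "eval (\<lambda>i. v $ i) (dist_pp ?m L u) = 0"
      proof (rule eval_dist_pp_eq_0)
        show "i < ?m" "lookup t i < lookup u i" using i by simp_all
        show "eval (\<lambda>i. v $ i) (L i (lookup t i)) = 0"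
          unfolding v using i(1) P(1)[of "lookup t"] P(2)[of i "lookup t"]
          by (simp add: eval_smult_linear_form[OF lin] pt_def)
      qed
    qed
    moreover have "mpoly.subspace (ideal_of_points ?m X)"
      unfolding ideal_of_points_def by (rule subspace_of_ideal[OF genideal_ideal[OF G_sub]])
    ultimately show "?J \<subseteq> ideal_of_points ?m X"
      unfolding ideal_of_points_def using genideal_self[OF G_sub]
      by (intro mpoly.span_minimal) blast+
    have "?G \<subseteq> ?J"
    proof
      fix p assume p: "p \<in> ?G"
      then obtain d where "\<forall>t\<in>keys p. pp_deg t = d" unfolding homogeneous_def by blast
      then have "p \<in> supported (pps_of_deg ?m d)"
        using p by (auto simp: carrier_poly_ring supported_def)
      also have "supported (pps_of_deg ?m d) = distraction ?m L ` supported (pps_of_deg ?m d)"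
        unfolding distraction_image by (rule supported_deg_eq_span_dist_pp[OF L])
      finally obtain q where q: "p = distraction ?m L q" "q \<in> supported (pps_of_deg ?m d)" by (rule imageE)
      have "keys q \<subseteq> T"
      proof (rule ccontr)
        assume "\<not> keys q \<subseteq> T"
        define A where "A = keys q - T"
        define w where "w t = (\<Sum>i<n. lookup t i)" for t :: "nat pp"
        obtain t0 where "t0 \<in> A" using \<open>\<not> keys q \<subseteq> T\<close> unfolding A_def by blast
        then obtain t where t: "t \<in> A" "\<And>u. u \<in> A \<Longrightarrow> w t \<le> w u"
          using ex_has_least_nat[of "\<lambda>t. t \<in> A" t0 w] by blast
        have deg: "u \<in> pps ?m" "pp_deg u = d" if "u \<in> keys q" for u
          using q(2) that by (auto simp: supported_def)
        have tq: "t \<in> keys q" "t \<notin> T" using t(1) by (simp_all add: A_def)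
        define s where "s = drop_var n t"
        have s: "s \<in> pps n - T0"
          using tq deg(1)[OF tq(1)] drop_var_pps[OF deg(1)[OF tq(1)]] by (simp add: s_def T_eq)
        have st: "lookup s i = lookup t i" if "i < n" for i
          using that by (simp add: s_def lookup_drop_var)
        let ?a = "\<lambda>i. pt s $ i"
        have a0: "eval ?a (L i (lookup s i)) = 0" if "i < n" for i
          unfolding pt_def by (rule P(2)[OF that])
        have a1: "eval ?a (L n (lookup s n)) \<noteq> 0"
          unfolding pt_def using P(3) by simp
        have other: "eval ?a (dist_pp ?m L u) = 0" if u: "u \<in> keys q" "u \<noteq> t" for u
        proof -
          have "\<exists>i<n. lookup s i < lookup u i"
          proof (cases "u \<in> T")
            case True
            then show ?thesis using s by (rule T_exponent_gt)
          next
            case False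
            then have "w t \<le> w u" using u(1) by (intro t(2)) (simp add: A_def)
            show ?thesis
            proof (rule ccontr)
              assume "\<not> (\<exists>i<n. lookup s i < lookup u i)"
              then have le: "lookup u i \<le> lookup t i" if "i < n" for i
                using st[OF that] that by (metis leI)
              have eq: "lookup u i = lookup t i" if "i < n" for i
              proof (rule ccontr)
                assume "lookup u i \<noteq> lookup t i"
                then have "w u < w t"
                  unfolding w_def using that le
                  by (intro sum_strict_mono_ex1) (auto intro!: bexI[of _ i] simp: le_neq_implies_less)
                then show False using \<open>w t \<le> w u\<close> by simp
              qed
              \<comment> \<open>All terms of \<open>q\<close> have degree \<open>d\<close>, so the
                first \<open>n\<close> exponents determine the last one.\<close>
              have "(\<Sum>i<?m. lookup u i) = (\<Sum>i<?m. lookup t i)"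
                using deg[OF u(1)] deg[OF tq(1)] by (simp add: pp_deg_superset[of "{..<?m}"])
              moreover have "(\<Sum>i<n. lookup u i) = (\<Sum>i<n. lookup t i)" by (simp add: eq)
              ultimately have "lookup u n = lookup t n" by simp
              then have "lookup u i = lookup t i" for i
                using eq[of i] deg(1)[OF u(1)] deg(1)[OF tq(1)]
                by (cases i n rule: linorder_cases) (simp_all add: pps_iff)
              then have "u = t" by (rule poly_mapping_eqI)
              then show False using u(2) by simp
            qed
          qed
          then obtain i where "i < n" "lookup s i < lookup u i" by blast
          then show ?thesis using a0 by (intro eval_dist_pp_eq_0[of i _ "lookup s i"]) simp_all
        qed
        obtain e where e: "radical_for_irr L e" "keys e = {..<n}" "\<And>i. i < n \<Longrightarrow> lookup s i < lookup e i"
          using radical_corner[OF rad s] by blast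
        \<comment> \<open>No factor of D(t) vanishes: in row \<open>n\<close> by the spanning
          condition, in the other rows by radicality, as only columns below
          \<open>lookup t i\<close> occur.\<close>
        have "eval ?a (L i j) \<noteq> 0" if "i < ?m" "j < lookup t i" for i j
        proof (cases "i = n")
          case True
          then show ?thesis using distraction_point_last_nonzero[OF L a0 a1] by simp
        next
          case False
          then have "i < n" using that(1) by simp
          then show ?thesis
            using that(2) st by (intro distraction_point_other_nonzero[OF L a0 a1 e]) simp_all
        qed
        then have nz: "eval ?a (dist_pp ?m L t) \<noteq> 0" unfolding eval_dist_pp by simp
        interpret ev: comm_ring_hom "eval ?a :: (nat, 'k) mpoly \<Rightarrow> 'k"
          by (rule comm_ring_hom_poly_hom[OF comm_ring_hom_id])
        have "pt s \<in> proj_rel ?m `` {pt s}"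
          using pt_carrier[of s] by (auto simp: proj_rel_def intro!: exI[of _ 1])
        then have "eval ?a p = 0" using p s unfolding X_def by blast
        moreover have "eval ?a p = (\<Sum>u\<in>keys q. lookup q u * eval ?a (dist_pp ?m L u))"
          unfolding q(1) distraction_superset[OF finite_keys order_refl] ev.hom_sum
          by (simp add: poly_hom_scale[OF comm_ring_hom_id])
        moreover have "\<dots> = (\<Sum>u\<in>{t}. lookup q u * eval ?a (dist_pp ?m L u))"
          by (rule sum.mono_neutral_right) (use tq other in auto)
        ultimately have "lookup q t * eval ?a (dist_pp ?m L t) = 0" by simp
        then show False using nz tq(1) by (simp add: in_keys_iff)
      qed
      then show "p \<in> ?J"
        unfolding q(1) distraction_image[symmetric] by (intro imageI) (simp add: supported_def)
    qed
    then show "ideal_of_points ?m X \<subseteq> ?J"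
      unfolding ideal_of_points_def
      by (intro genideal_minimal ideal_span_dist_pp[OF L T_pps] T_add) simp_all
  qed
  ultimately show ?thesis by blast
qed

end

section \<open>Transfer of the hypotheses on I to exponent sets, and conclusion\<close>

lemma strongly_stable_extend:
  assumes T: "T = {u \<in> pps (Suc n). drop_var n u \<in> T0}" and "T0 \<subseteq> pps n"
    and up: "\<And>s u. s \<in> T0 \<Longrightarrow> u \<in> pps n \<Longrightarrow> s + u \<in> T0"
    and st: "stable_pps T0"
  shows "stable_pps T"
  unfolding stable_pps_def
proof (intro ballI allI impI)
  fix t j i assume "t \<in> T" and j: "j \<in> keys t" and ij: "i \<le> j"
  then have t: "t \<in> pps (Suc n)" "drop_var n t \<in> T0" by (simp_all add: T)
  let ?t = "t - unit_pp j + unit_pp i"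
  have jn: "j < Suc n" using t(1) j by auto
  have t': "?t \<in> pps (Suc n)" using t(1) ij jn
    by (auto simp: pps_iff lookup_add lookup_minus lookup_single when_def)
  moreover have "drop_var n ?t \<in> T0"
  proof (cases "j = n")
    case False
    then have "drop_var n ?t = drop_var n t - unit_pp j + unit_pp i"
      using ij jn by (intro poly_mapping_eqI)
        (simp add: lookup_drop_var lookup_add lookup_minus lookup_single when_def)
    moreover have "j \<in> keys (drop_var n t)" using False j by (simp add: in_keys_iff lookup_drop_var)
    ultimately show ?thesis using st t(2) ij unfolding stable_pps_def by metis
  next
    \<comment> \<open>Trading the extra variable for \<open>var i\<close> multiplies the remaining
      part by \<open>var i\<close>, or leaves it unchanged if \<open>i = n\<close>.\<close>
    case True
    have eq: "drop_var n ?t = drop_var n t + (if i = n then 0 else unit_pp i)"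
      using True by (intro poly_mapping_eqI)
        (simp add: lookup_drop_var lookup_add lookup_minus lookup_single when_def)
    have "(if i = n then 0 else unit_pp i) \<in> pps n" using ij jn by auto
    then show ?thesis unfolding eq by (rule up[OF t(2)])
  qed
  ultimately show "?t \<in> T" by (simp add: T)
qed

text \<open>Each exponent of a standard power product is bounded by that of a pure power in
  \<open>T0\<close>, which bounds the degree.\<close>

lemma finite_standard_of_pure_powers:
  assumes "\<And>s u. s \<in> T0 \<Longrightarrow> u \<in> pps n \<Longrightarrow> s + u \<in> T0"
    and "\<And>i. i < n \<Longrightarrow> \<exists>e. Poly_Mapping.single i e \<in> T0"
  shows "finite (pps n - T0)"
proof -
  obtain e where e: "\<And>i. i < n \<Longrightarrow> Poly_Mapping.single i (e i) \<in> T0"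
    using assms(2) by metis
  have "pps n - T0 \<subseteq> (\<Union>d\<le>(\<Sum>i<n. e i). pps_of_deg n d)"
  proof
    fix t assume t: "t \<in> pps n - T0"
    have "lookup t i \<le> e i" if "i < n" for i
    proof (rule ccontr)
      assume "\<not> lookup t i \<le> e i"
      then have eq: "t = Poly_Mapping.single i (e i) + (t - Poly_Mapping.single i (e i))"
        by (intro pp_diff_add) (auto simp: lookup_single when_def)
      have "t - Poly_Mapping.single i (e i) \<in> pps n"
        using t by (simp add: pps_iff lookup_minus)
      then have "Poly_Mapping.single i (e i) + (t - Poly_Mapping.single i (e i)) \<in> T0"
        by (rule assms(1)[OF e[OF that]])
      then have "t \<in> T0" unfolding eq[symmetric] .
      then show False using t by simp
    qed
    then have "(\<Sum>i<n. lookup t i) \<le> (\<Sum>i<n. e i)" by (intro sum_mono) simp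
    moreover have "pp_deg t = (\<Sum>i<n. lookup t i)"
      using t by (intro pp_deg_superset) simp_all
    ultimately show "t \<in> (\<Union>d\<le>(\<Sum>i<n. e i). pps_of_deg n d)" using t by simp
  qed
  then show ?thesis by (rule finite_subset) (intro finite_UN_I finite_atMost finite_pps_deg)
qed

theorem corollary4p10:
  fixes n :: nat
    and I IP :: "(nat, 'k::field) mpoly set"
    and L :: "nat \<Rightarrow> nat \<Rightarrow> (nat, 'k) mpoly"
  assumes "infinite (UNIV :: 'k set)"
    and "monomial_ideal n I"
    and "strongly_stable I"
    and "has_krull_dim (poly_ring n Quot I) 0"
    and "IP = Idl\<^bsub>poly_ring (n + 1)\<^esub> I"
    and "distraction_matrix (n + 1) L"
    and "radical_for (n + 1) L IP"
  shows "(\<exists>X \<subseteq> proj_points (n + 1). finite X \<and>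
            distraction (n + 1) L ` IP = ideal_of_points (n + 1) X) \<and>
         is_gin (n + 1) (distraction (n + 1) L ` IP) IP"
proof -
  let ?m = "Suc n"
  have m: "n + 1 = ?m" by simp
  obtain S where S: "S \<subseteq> pps n" "I = Idl\<^bsub>poly_ring n\<^esub> (mon ` S)"
    using assms(2) unfolding monomial_ideal_def by blast
  \<comment> \<open>\<open>T0\<close> and \<open>T\<close> are the exponents of I and of its
    extension; \<open>T\<close> allows any power of the extra variable.\<close>
  define T0 where "T0 = {s + u | s u. s \<in> S \<and> u \<in> pps n}"
  define T where "T = {u \<in> pps ?m. drop_var n u \<in> T0}"
  have I: "I = supported T0" unfolding S(2) T0_def by (rule Idl_mon[OF S(1)])
  have T0_pps: "T0 \<subseteq> pps n" using S(1) unfolding T0_def by (force simp: keys_add_nat)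
  have T0_add: "s + u \<in> T0" if s: "s \<in> T0" and u: "u \<in> pps n" for s u
  proof -
    obtain a b where ab: "s = a + b" "a \<in> S" "b \<in> pps n" using s unfolding T0_def by blast
    have "s + u = a + (b + u)" by (simp add: ab(1) add.assoc)
    moreover have "b + u \<in> pps n" using ab(3) u by (simp add: keys_add_nat)
    ultimately show ?thesis using ab(2) unfolding T0_def by blast
  qed
  have "ideal (supported T0 :: (nat, 'k) mpoly set) (poly_ring n)"
    unfolding I[symmetric] S(2)
    by (rule ring.genideal_ideal[OF cring.axioms(1)[OF cring_poly_ring]])
      (use S(1) in \<open>auto simp: carrier_poly_ring\<close>)
  \<comment> \<open>Zero-dimensionality enters here: it gives pure powers of all variables, and so
    finitely many standard power products.\<close>
  then have pure: "\<exists>e. Poly_Mapping.single i e \<in> T0" if "i < n" for i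
    by (rule krull_dim_0_pure_power[OF T0_pps _ _ that]) (use assms(4) in \<open>simp add: I\<close>)
  have fin: "finite (pps n - T0)"
    by (rule finite_standard_of_pure_powers) (rule T0_add pure; assumption)+
  interpret zero_dim_pps n T0 T
    by unfold_locales (simp_all add: T0_pps T0_add T_def fin del: mem_Collect_eq)
  interpret R: cring "poly_ring ?m :: (nat, 'k) mpoly ring" by (rule cring_poly_ring)
  have Idl_T0: "Idl\<^bsub>poly_ring ?m\<^esub> (mon ` T0) = (supported T :: (nat, 'k) mpoly set)"
    by (rule Idl_mon_T[OF order_refl T0_subset_T])
  have sub: "supported T0 \<subseteq> carrier (poly_ring ?m :: (nat, 'k) mpoly ring)"
    unfolding carrier_poly_ring by (rule supported_mono[OF subset_trans[OF T0_subset_T T_pps]])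
  have "mon ` T0 \<subseteq> (supported T0 :: (nat, 'k) mpoly set)" by auto
  then have gens: "mon ` T0 \<subseteq> carrier (poly_ring ?m :: (nat, 'k) mpoly ring)"
    using sub by (rule subset_trans)
  have IP: "IP = supported T"
  proof
    have "ideal (supported T :: (nat, 'k) mpoly set) (poly_ring ?m)"
      unfolding Idl_T0[symmetric] by (rule R.genideal_ideal[OF gens])
    then show "IP \<subseteq> supported T"
      unfolding assms(5) I m by (rule R.genideal_minimal[OF _ supported_mono[OF T0_subset_T]])
    show "supported T \<subseteq> IP"
      unfolding assms(5) I m Idl_T0[symmetric]
      by (rule R.genideal_minimal[OF R.genideal_ideal[OF sub]])
        (rule subset_trans[OF \<open>mon ` T0 \<subseteq> supported T0\<close> R.genideal_self[OF sub]])
  qed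
  have stable_T0: "stable_pps T0"
    using assms(3) unfolding strongly_stable_def stable_pps_def I by simp
  then have stable: "stable_pps T"
    by (intro strongly_stable_extend[OF T_def T0_pps] T0_add)
  have L: "distraction_matrix ?m L" and rad: "radical_for ?m L (supported T)"
    using assms(6,7) by (simp_all only: m IP)
  have points: "\<exists>X \<subseteq> proj_points ?m. finite X \<and>
      distraction ?m L ` IP = ideal_of_points ?m X"
    unfolding IP distraction_image by (rule distraction_ideal_of_points[OF L rad])
  obtain U where U: "zariski_open_GL ?m U" "U \<noteq> {}"
    "\<forall>g\<in>U. flag_generic ?m (\<lambda>i j. GL_act ?m g (L i j))"
    using generic_flag[OF assms(1) L] by blast
  \<comment> \<open>For \<open>g\<close> in the open set the transformed matrix is
    \<open>flag_generic\<close>, so the leading power products of the transformed ideal are those in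
    \<open>T\<close>, and their monomials generate \<open>supported T\<close>.\<close>
  have "initial_ideal ?m (GL_act ?m g ` distraction ?m L ` IP) = IP" if "g \<in> U" for g
  proof -
    let ?M = "\<lambda>i j. GL_act ?m g (L i j)"
    have "{mon t | t p. p \<in> mpoly.span (dist_pp ?m ?M ` T) \<and> is_leading_pp p t} =
      mon ` {t. \<exists>p \<in> mpoly.span (dist_pp ?m ?M ` T). is_leading_pp p t}" by blast
    also have "\<dots> = mon ` T"
      using leading_pps_distraction[OF _ T_pps stable, of ?M] U(3) that by simp
    finally have lead: "{mon t | t p. p \<in> mpoly.span (dist_pp ?m ?M ` T) \<and> is_leading_pp p t} = mon ` T" .
    show ?thesis
      unfolding initial_ideal_def IP distraction_image GL_act_span_dist_pp lead
      by (rule Idl_mon_T[OF T0_subset_T order_refl])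
  qed
  moreover have "monomial_ideal ?m IP"
    unfolding monomial_ideal_def IP Idl_T0[symmetric]
    using subset_trans[OF T0_subset_T T_pps] by (intro exI[of _ T0]) auto
  ultimately have "is_gin ?m (distraction ?m L ` IP) IP"
    unfolding is_gin_def using U(1,2) by blast
  then show ?thesis unfolding m using points by blast
qed

end
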